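(* Let $G$ be an interval graph, let $C_1,\dots,C_s$ be a clique path of $G$, let $u_1$ be a vertex of $G$ that belongs to $C_1$ and to no other clique $C_j$ with $j\neq 1$, and let $u_n$ be a vertex of $G$ that belongs to $C_s$ and to no other clique $C_j$ with $j\neq s$. Then for every positive integer $p$, $G$ contains a spanning $p$-stave between $u_1$ and $u_n$ if and only if $\mathrm{scat}(G)\le 2-p$.
   Context: All graphs are finite, undirected, without loops or multiple edges. An interval graph is the intersection graph of a finite set of closed intervals on the real line. A clique path of an interval graph $G$ is a sequence $C_1,\dots,C_s$ of all maximal cliques of $G$ such that every edge of $G$ lies in some $C_i$ and each vertex of $G$ lies only in consecutively indexed cliques (i.e., $\{j : v\in C_j\}$ is a set of consecutive integers for each vertex $v$). For a graph $G$, $c(G)$ denotes its number of connected components. The scattering number is $\mathrm{scat}(G)=\max\{c(G-S)-|S| : S\subset V(G),\ c(G-S)\ge 2\}$, with $\mathrm{scat}(G)=-\infty$ if $G$ is complete. A $p$-stave between vertices $u$ and $v$ is a set of $p$ paths $P_1,\dots,P_p$, each having end-vertices $u$ and $v$, which are pairwise internally vertex-disjoint; it is spanning if $V(P_1)\cup\cdots\cup V(P_p)=V(G)$.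
   Formalization: The vertices u_1 and u_n are assumed distinct (for complete G with at least 2 vertices and u_1 = u_n the claim fails), and the p paths of a stave form a family in which the one-edge path may repeat, which matters only for complete G. *)

theory Defs
  imports "Graph_Theory.Graph_Theory" "HOL-Library.Extended_Real"
begin

text \<open>
  A finite simple undirected graph is a \<^term>\<open>graph G\<close> of Graph_Theory: a finite symmetric
  digraph without loops or parallel arcs, so that an edge is a pair of opposite arcs.
\<close>

text \<open>Distinct vertices may share an interval; perturbing the endpoints makes the intervals
  distinct without changing the intersection graph.\<close>

definition interval_graph :: "('a, 'b) pre_digraph \<Rightarrow> bool" where
  "interval_graph G \<longleftrightarrow> graph G \<and>
    (\<exists>l r :: 'a \<Rightarrow> real.
      (\<forall>v \<in> verts G. l v \<le> r v) \<and>
      (\<forall>u \<in> verts G. \<forall>v \<in> verts G. u \<noteq> v \<longrightarrow>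
        (u \<rightarrow>\<^bsub>G\<^esub> v \<longleftrightarrow> {l u..r u} \<inter> {l v..r v} \<noteq> {})))"

definition clique :: "('a, 'b) pre_digraph \<Rightarrow> 'a set \<Rightarrow> bool" where
  "clique G K \<longleftrightarrow> K \<subseteq> verts G \<and> (\<forall>u \<in> K. \<forall>v \<in> K. u \<noteq> v \<longrightarrow> u \<rightarrow>\<^bsub>G\<^esub> v)"

definition maximal_clique :: "('a, 'b) pre_digraph \<Rightarrow> 'a set \<Rightarrow> bool" where
  "maximal_clique G K \<longleftrightarrow> clique G K \<and> (\<forall>K'. clique G K' \<and> K \<subseteq> K' \<longrightarrow> K' = K)"

definition clique_path :: "('a, 'b) pre_digraph \<Rightarrow> 'a set list \<Rightarrow> bool" where
  "clique_path G Cs \<longleftrightarrow>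
    distinct Cs \<and> set Cs = {K. maximal_clique G K} \<and>
    (\<forall>u v. u \<rightarrow>\<^bsub>G\<^esub> v \<longrightarrow> (\<exists>i < length Cs. u \<in> Cs ! i \<and> v \<in> Cs ! i)) \<and>
    (\<forall>v \<in> verts G. \<forall>i j k. i \<le> j \<and> j \<le> k \<and> k < length Cs \<and> v \<in> Cs ! i \<and> v \<in> Cs ! k
      \<longrightarrow> v \<in> Cs ! j)"

text \<open>In a symmetric digraph the strongly connected components are the connected components
  of the undirected graph.\<close>

definition num_components :: "('a, 'b) pre_digraph \<Rightarrow> nat" where
  "num_components G = card (pre_digraph.sccs_verts G)"

text \<open>In a finite non-complete graph the maximum is over a finite nonempty set: for
  non-adjacent \<open>u \<noteq> v\<close>, take \<open>S = verts G - {u, v}\<close>.\<close>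

definition scat :: "('a, 'b) pre_digraph \<Rightarrow> ereal" where
  "scat G = (if complete_digraph (card (verts G)) G then -\<infinity>
    else ereal (of_int (Max {int (num_components (G \<restriction> (verts G - S))) - int (card S) | S.
      S \<subseteq> verts G \<and> num_components (G \<restriction> (verts G - S)) \<ge> 2})))"

text \<open>
  The paths form a family \<open>P\<^sub>1, \<dots>, P\<^sub>p\<close>. Internal disjointness makes its members
  distinct, except that the one-edge path \<open>u v\<close> has no internal vertices and may be repeated.
  Repetition matters only when \<open>u\<close> and \<open>v\<close> are adjacent; it is what lets a complete graph
  have spanning \<open>p\<close>-staves for all \<open>p\<close>, in accordance with scattering number \<open>-\<infinity>\<close>.
\<close>

definition stave ::
  "('a, 'b) pre_digraph \<Rightarrow> nat \<Rightarrow> 'a \<Rightarrow> 'a \<Rightarrow> 'b awalk list \<Rightarrow> bool" where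
  "stave G p u v Ps \<longleftrightarrow> length Ps = p \<and>
    (\<forall>P \<in> set Ps. pre_digraph.apath G u P v) \<and>
    (\<forall>i < p. \<forall>j < p. i \<noteq> j \<longrightarrow>
      set (pre_digraph.awalk_verts G u (Ps ! i)) \<inter> set (pre_digraph.awalk_verts G u (Ps ! j))
        \<subseteq> {u, v})"

definition spanning_stave ::
  "('a, 'b) pre_digraph \<Rightarrow> nat \<Rightarrow> 'a \<Rightarrow> 'a \<Rightarrow> 'b awalk list \<Rightarrow> bool" where
  "spanning_stave G p u v Ps \<longleftrightarrow> stave G p u v Ps \<and>
    (\<Union>P \<in> set Ps. set (pre_digraph.awalk_verts G u P)) = verts G"

end

theory Submission
  imports Defs
begin

text \<open>
  Order the vertices by the last clique containing them, with \<open>u\<^sub>1\<close> first and \<open>u\<^sub>n\<close> last. Then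
  \<open>i < j < k\<close> and \<open>i \<sim> k\<close> imply \<open>j \<sim> k\<close>, so the later neighbours of \<open>t\<close> separate \<open>{..t}\<close> from the
  remaining vertices.

  Given a spanning \<open>p\<close>-stave and a set \<open>S\<close> avoiding both ends, every component of \<open>G - S\<close> except
  that of \<open>u\<^sub>n\<close> is left by some path through a vertex of \<open>S\<close>, and the component of \<open>u\<^sub>1\<close> by all
  \<open>p\<close> paths, whence \<open>c(G - S) \<le> |S| + 2 - p\<close>. The ends can be removed from \<open>S\<close> because they are
  simplicial, and they lie in different components as soon as \<open>G - S\<close> is disconnected.

  Conversely, \<open>p\<close> strands are grown from \<open>u\<^sub>1\<close> while the vertices \<open>t\<close> are scanned in order. If \<open>t\<close>
  is the end of a strand, that strand is extended by the smallest unused later neighbour \<open>w\<close> of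
  \<open>t\<close>; if \<open>t\<close> is unused, the strand with the smallest end is extended by \<open>t, w\<close>. Whenever no such
  \<open>w\<close> exists, tracing back the choices that block the way yields a set \<open>T\<close> of scanned vertices
  whose later neighbours form a set \<open>S\<close> with \<open>c(G - S) \<ge> |T| + 1 > |S| + 2 - p\<close>. When the
  neighbours of \<open>u\<^sub>n\<close> are reached, everything left is a clique and the strands can be closed.
\<close>

section \<open>Staves as families of vertex lists\<close>

text \<open>Vertex lists, unlike arc walks, are easily cut, reversed and relabelled. Only the values
  of \<open>Q\<close> below \<open>p\<close> matter, and as in \<open>stave\<close> the list
  \<open>[u, v]\<close> may be repeated.\<close>

definition list_stave ::
  "('v \<Rightarrow> 'v \<Rightarrow> bool) \<Rightarrow> 'v set \<Rightarrow> nat \<Rightarrow> 'v \<Rightarrow> 'v \<Rightarrow> (nat \<Rightarrow> 'v list) \<Rightarrow> bool" where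
  "list_stave adj V p u v Q \<longleftrightarrow>
     (\<forall>i<p. Q i \<noteq> [] \<and> successively adj (Q i) \<and> distinct (Q i) \<and> hd (Q i) = u \<and> last (Q i) = v) \<and>
     (\<forall>i<p. \<forall>j<p. i \<noteq> j \<longrightarrow> set (Q i) \<inter> set (Q j) \<subseteq> {u, v}) \<and> (\<Union>i<p. set (Q i)) = V"

lemma list_stave_map:
  assumes "bij_betw f A V" "u \<in> A" "v \<in> A" and Q: "list_stave (\<lambda>i j. adj (f i) (f j)) A p u v Q"
  shows "list_stave adj V p (f u) (f v) (\<lambda>i. map f (Q i))"
proof -
  have inj: "inj_on f A" and V: "f ` A = V" using assms(1) by (auto simp: bij_betw_def)
  have Q1: "Q i \<noteq> []" "successively (\<lambda>i j. adj (f i) (f j)) (Q i)" "distinct (Q i)" "hd (Q i) = u" "last (Q i) = v"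
    "set (Q i) \<subseteq> A" if "i < p" for i
    using Q that by (auto simp: list_stave_def)
  have "set (map f (Q i)) \<inter> set (map f (Q j)) \<subseteq> {f u, f v}" if "i < p" "j < p" "i \<noteq> j" for i j
  proof -
    have "set (map f (Q i)) \<inter> set (map f (Q j)) = f ` (set (Q i) \<inter> set (Q j))"
      using inj_on_image_Int[OF inj Q1(6)[OF that(1)] Q1(6)[OF that(2)]] by simp
    also have "\<dots> \<subseteq> f ` {u, v}" using Q that unfolding list_stave_def by (intro image_mono) blast
    finally show ?thesis by simp
  qed
  moreover have "(\<Union>i<p. set (map f (Q i))) = V"
  proof -
    have "(\<Union>i<p. set (map f (Q i))) = f ` (\<Union>i<p. set (Q i))" by auto
    then show ?thesis using Q V by (simp add: list_stave_def)
  qed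
  moreover have "distinct (map f (Q i))" if "i < p" for i
    using Q1(3,6)[OF that] inj by (simp add: distinct_map inj_on_subset)
  ultimately show ?thesis unfolding list_stave_def
    using Q1 by (simp add: successively_map hd_map last_map)
qed

text \<open>Serves the case of adjacent ends, where the graph is complete: one path takes all
  vertices, and the others are copies of the edge from \<open>u\<close> to \<open>v\<close>, which
  has no inner vertices.\<close>

lemma list_stave_complete:
  assumes "distinct (u # xs @ [v])" "p \<ge> 1"
    and "\<And>x y. \<lbrakk>x \<in> set (u # xs @ [v]); y \<in> set (u # xs @ [v]); x \<noteq> y\<rbrakk> \<Longrightarrow> adj x y"
  shows "list_stave adj (set (u # xs @ [v])) p u v (\<lambda>i. if i = 0 then u # xs @ [v] else [u, v])"
proof -
  have "successively adj ys" if "distinct ys" "set ys \<subseteq> set (u # xs @ [v])" for ys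
    using that
  proof (induction ys)
    case (Cons y ys)
    then show ?case using assms(3)[of y "hd ys"] by (cases ys) auto
  qed simp
  then have "successively adj (u # xs @ [v])" using assms(1) by blast
  moreover have "adj u v" using assms(1,3) by auto
  moreover have "(\<Union>i<p. set (if i = 0 then u # xs @ [v] else [u, v])) = set (u # xs @ [v])"
  proof
    show "set (u # xs @ [v]) \<subseteq> (\<Union>i<p. set (if i = 0 then u # xs @ [v] else [u, v]))"
      using assms(2) by (intro UN_upper[of 0, THEN subset_trans[rotated]]) auto
  qed (auto split: if_splits)
  ultimately show ?thesis using assms(1) unfolding list_stave_def by auto
qed

section \<open>Arc walks and vertex lists\<close>

context wf_digraph
begin

lemma awalk_verts_successively:
  "awalk u P v \<Longrightarrow> successively (\<lambda>x y. x \<rightarrow> y) (awalk_verts u P) \<and> hd (awalk_verts u P) = u \<and> last (awalk_verts u P) = v"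
  by (induction P arbitrary: u) (auto simp: awalk_simps successively_Cons intro: in_arcs_imp_in_arcs_ends)

lemma awalk_of_vertex_list:
  assumes "xs \<noteq> []" "successively (\<lambda>x y. x \<rightarrow> y) xs" "hd xs \<in> verts G"
  shows "\<exists>P. awalk (hd xs) P (last xs) \<and> awalk_verts (hd xs) P = xs"
  using assms
proof (induction xs)
  case (Cons x xs)
  show ?case
  proof (cases "xs = []")
    case True
    then show ?thesis using Cons.prems by (intro exI[of _ "[]"]) (auto simp: awalk_simps)
  next
    case False
    then have "x \<rightarrow> hd xs" "successively (\<lambda>x y. x \<rightarrow> y) xs" using Cons.prems by (auto simp: successively_Cons)
    moreover from this obtain e where e: "e \<in> arcs G" "tail G e = x" "head G e = hd xs"
      by (auto simp: arcs_ends_conv)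
    moreover have "hd xs \<in> verts G" using e head_in_verts by metis
    ultimately obtain P where "awalk (hd xs) P (last xs)" "awalk_verts (hd xs) P = xs"
      using Cons.IH False by blast
    then show ?thesis using e False by (intro exI[of _ "e # P"]) (auto simp: awalk_simps)
  qed
qed simp

lemma ex_spanning_stave_iff:
  assumes u: "u \<in> verts G"
  shows "(\<exists>Ps. spanning_stave G p u v Ps) \<longleftrightarrow> (\<exists>Q. list_stave (\<lambda>x y. x \<rightarrow> y) (verts G) p u v Q)"
proof
  assume "\<exists>Ps. spanning_stave G p u v Ps"
  then obtain Ps where Ps: "spanning_stave G p u v Ps" by blast
  then have len: "length Ps = p" and path: "\<And>i. i < p \<Longrightarrow> apath u (Ps ! i) v"
    by (auto simp: spanning_stave_def stave_def)
  have "(\<Union>i<p. set (awalk_verts u (Ps ! i))) = (\<Union>P\<in>set Ps. set (awalk_verts u P))"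
    using len by (auto simp: set_conv_nth)
  then have "list_stave (\<lambda>x y. x \<rightarrow> y) (verts G) p u v (\<lambda>i. awalk_verts u (Ps ! i))"
    unfolding list_stave_def using Ps path
    by (auto simp: spanning_stave_def stave_def apath_def dest: awalk_verts_successively)
  then show "\<exists>Q. list_stave (\<lambda>x y. x \<rightarrow> y) (verts G) p u v Q" by blast
next
  assume "\<exists>Q. list_stave (\<lambda>x y. x \<rightarrow> y) (verts G) p u v Q"
  then obtain Q where Q: "list_stave (\<lambda>x y. x \<rightarrow> y) (verts G) p u v Q" by blast
  have "\<exists>P. apath u P v \<and> awalk_verts u P = Q i" if "i < p" for i
  proof -
    have Qi: "Q i \<noteq> []" "successively (\<lambda>x y. x \<rightarrow> y) (Q i)" "distinct (Q i)" "hd (Q i) = u" "last (Q i) = v"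
      using Q that by (simp_all add: list_stave_def)
    then obtain P where "awalk u P v" "awalk_verts u P = Q i"
      using awalk_of_vertex_list[of "Q i"] u by blast
    then show ?thesis using Qi(3) by (auto simp: apath_def)
  qed
  then obtain P where P: "\<And>i. i < p \<Longrightarrow> apath u (P i) v \<and> awalk_verts u (P i) = Q i" by metis
  have "(\<Union>A\<in>set (map P [0..<p]). set (awalk_verts u A)) = (\<Union>i<p. set (Q i))"
    using P by auto
  then have "spanning_stave G p u v (map P [0..<p])"
    using P Q by (auto simp: spanning_stave_def stave_def list_stave_def)
  then show "\<exists>Ps. spanning_stave G p u v Ps" by blast
qed

end

section \<open>Counting components along a stave\<close>

text \<open>Labels are constant along edges outside \<open>S\<close>. Following the list from
  \<open>x\<close>, the label therefore persists until \<open>S\<close> is first entered, and this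
  must happen because the final label differs.\<close>

lemma label_change_on_list:
  assumes "successively adj xs" "x \<in> set xs" "x \<notin> S" "last xs \<notin> S" "\<kappa> x \<noteq> \<kappa> (last xs)"
    and "\<And>a b. \<lbrakk>a \<in> set xs; b \<in> set xs; a \<notin> S; b \<notin> S; adj a b\<rbrakk> \<Longrightarrow> \<kappa> a = \<kappa> b"
  shows "\<exists>ys a s zs. xs = ys @ a # s # zs \<and> a \<notin> S \<and> \<kappa> a = \<kappa> x \<and> s \<in> S"
  using assms
proof (induction xs arbitrary: x)
  case (Cons c xs)
  show ?case
  proof (cases "x \<in> set xs")
    case True
    then have "\<exists>ys a s zs. xs = ys @ a # s # zs \<and> a \<notin> S \<and> \<kappa> a = \<kappa> x \<and> s \<in> S"
      using Cons.prems by (intro Cons.IH) (auto simp: successively_Cons split: if_splits)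
    then show ?thesis by (metis append_Cons)
  next
    case False
    then have x: "x = c" using Cons.prems by simp
    obtain d zs where xs: "xs = d # zs" using Cons.prems(5) x by (cases xs) auto
    show ?thesis
    proof (cases "d \<in> S")
      case True
      then show ?thesis using x xs Cons.prems(3) by (metis append_Nil)
    next
      case False
      have "\<kappa> d = \<kappa> x" using Cons.prems(1,3) Cons.prems(6)[of c d] False x xs by (simp add: successively_Cons)
      moreover have "\<exists>ys a s zs. xs = ys @ a # s # zs \<and> a \<notin> S \<and> \<kappa> a = \<kappa> d \<and> s \<in> S"
        using Cons.prems False xs \<open>\<kappa> d = \<kappa> x\<close> by (intro Cons.IH) (auto simp: successively_Cons)
      ultimately show ?thesis by (metis append_Cons)
    qed
  qed
qed simp

text \<open>Every label class except that of \<open>v\<close> is left by some path through a vertex of \<open>S\<close>, and the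
  class of \<open>u\<close> is left by each of the \<open>p\<close> paths; all these exit vertices are distinct.\<close>

lemma card_labels_list_stave:
  fixes \<kappa> :: "'a \<Rightarrow> 'c"
  assumes Q: "list_stave adj V p u v Q" and S: "finite V" "S \<subseteq> V" "u \<in> V" "v \<in> V" "u \<notin> S" "v \<notin> S"
    and \<kappa>: "\<And>a b. \<lbrakk>a \<in> V - S; b \<in> V - S; adj a b\<rbrakk> \<Longrightarrow> \<kappa> a = \<kappa> b" and uv: "\<kappa> u \<noteq> \<kappa> v"
  shows "card (\<kappa> ` (V - S)) + p \<le> card S + 2"
proof -
  have Q1: "Q i \<noteq> []" "successively adj (Q i)" "distinct (Q i)" "hd (Q i) = u" "last (Q i) = v"
    "set (Q i) \<subseteq> V" if "i < p" for i
    using Q that by (auto simp: list_stave_def)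
  \<comment> \<open>\<open>s\<close> is an exit vertex of the class \<open>k\<close> on path
    \<open>i\<close>. An inner vertex of the stave determines its path and its predecessor there,
    hence both \<open>i\<close> and \<open>k\<close>.\<close>
  define ex where "ex i s k \<longleftrightarrow> i < p \<and> s \<in> S \<and> (\<exists>ys a zs. Q i = ys @ a # s # zs \<and> \<kappa> a = k)" for i s k
  have exI': "\<exists>s. ex i s (\<kappa> x)" if "i < p" "x \<in> set (Q i)" "x \<notin> S" "\<kappa> x \<noteq> \<kappa> v" for i x
  proof -
    have "\<exists>ys a s zs. Q i = ys @ a # s # zs \<and> a \<notin> S \<and> \<kappa> a = \<kappa> x \<and> s \<in> S"
    proof (rule label_change_on_list)
      show "\<kappa> a = \<kappa> b" if "a \<in> set (Q i)" "b \<in> set (Q i)" "a \<notin> S" "b \<notin> S" "adj a b" for a b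
        using \<kappa> that Q1(6)[OF \<open>i < p\<close>] by blast
    qed (use Q1[OF \<open>i < p\<close>] S that in auto)
    then show ?thesis using that(1) by (auto simp: ex_def)
  qed
  have ex_unique: "i = j \<and> k = l" if "ex i s k" "ex j s l" for i j s k l
  proof -
    obtain ys a zs ys' b zs' where i: "i < p" "s \<in> S" "Q i = ys @ a # s # zs" "\<kappa> a = k"
      and j: "j < p" "Q j = ys' @ b # s # zs'" "\<kappa> b = l"
      using \<open>ex i s k\<close> \<open>ex j s l\<close> unfolding ex_def by blast
    have "s \<notin> {u, v}" using i(2) S by auto
    moreover have "s \<in> set (Q i) \<inter> set (Q j)" using i j by simp
    ultimately have ij: "i = j" using Q i(1) j(1) unfolding list_stave_def by blast
    have "(ys @ [a]) @ s # zs = (ys' @ [b]) @ s # zs'" using i(3) j(2) ij by simp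
    moreover have "distinct ((ys @ [a]) @ s # zs)" using Q1(3)[OF i(1)] i(3) by simp
    ultimately have "ys @ [a] = ys' @ [b]"
      by (metis append_Cons_eq_iff distinct_append distinct.simps(2) disjoint_iff list.set_intros(1)
          not_distinct_conv_prefix)
    then show ?thesis using ij i j by simp
  qed
  \<comment> \<open>The class of \<open>v\<close> need not be left, and that of \<open>u\<close> is
    accounted for by the \<open>p\<close> exits \<open>g i\<close>; \<open>h\<close> selects one
    exit for each remaining class.\<close>
  define K where "K = \<kappa> ` (V - S) - {\<kappa> u, \<kappa> v}"
  have "\<exists>s. \<exists>i. ex i s k" if "k \<in> K" for k
  proof -
    obtain x where x: "x \<in> V - S" "k = \<kappa> x" "\<kappa> x \<noteq> \<kappa> v" using \<open>k \<in> K\<close> by (auto simp: K_def)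
    then obtain i where "i < p" "x \<in> set (Q i)" using Q by (auto simp: list_stave_def)
    then show ?thesis using exI'[of i x] x by auto
  qed
  then obtain h where h: "\<And>k. k \<in> K \<Longrightarrow> \<exists>i. ex i (h k) k" by metis
  have "\<exists>s. ex i s (\<kappa> u)" if "i < p" for i
  proof -
    have "u \<in> set (Q i)" using Q1[OF that] hd_in_set by metis
    then show ?thesis using exI'[OF that] S uv by blast
  qed
  then obtain g where g: "\<And>i. i < p \<Longrightarrow> ex i (g i) (\<kappa> u)" by metis
  have finS: "finite S" using S finite_subset by blast
  have "inj_on h K" using h ex_unique by (metis inj_onI)
  moreover have "inj_on g {..<p}" using g ex_unique by (metis inj_onI lessThan_iff)
  moreover have "h ` K \<inter> g ` {..<p} = {}"
  proof -
    have "h k \<noteq> g i" if "k \<in> K" "i < p" for k i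
    proof
      assume "h k = g i"
      then have "k = \<kappa> u" using h[OF that(1)] g[OF that(2)] ex_unique by metis
      then show False using that(1) by (simp add: K_def)
    qed
    then show ?thesis by auto
  qed
  moreover have "h ` K \<union> g ` {..<p} \<subseteq> S" using h g by (auto simp: ex_def)
  moreover have "finite K" using S by (simp add: K_def)
  ultimately have "card K + p \<le> card S"
    using card_Un_disjoint[of "h ` K" "g ` {..<p}"] card_mono[OF finS, of "h ` K \<union> g ` {..<p}"]
    by (simp add: card_image)
  moreover have "card (\<kappa> ` (V - S)) \<le> card K + 2"
  proof -
    have "card (\<kappa> ` (V - S)) \<le> card (K \<union> {\<kappa> u, \<kappa> v})"
      using S by (intro card_mono) (auto simp: K_def)
    also have "\<dots> \<le> card K + card {\<kappa> u, \<kappa> v}" by (rule card_Un_le)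
    also have "card {\<kappa> u, \<kappa> v} \<le> 2" by (simp add: card_insert_if)
    finally show ?thesis by simp
  qed
  ultimately show ?thesis by simp
qed

section \<open>The greedy construction\<close>

text \<open>\<open>m\<close> is the smallest neighbour of the last vertex, or that vertex itself if
  it has none. In \<open>scattering\<close>, deleting \<open>S\<close> puts the members of
  \<open>T\<close> and \<open>n - 1\<close> into distinct components, so the inequality is the
  scattering bound with \<open>card T + 1\<close> as number of components.\<close>

locale greedy_staves =
  fixes n m p :: nat and adj :: "nat \<Rightarrow> nat \<Rightarrow> bool"
  assumes adj_sym: "adj i j \<Longrightarrow> adj j i"
    and adj_umbrella: "\<lbrakk>i < j; j < k; k < n; adj i k\<rbrakk> \<Longrightarrow> adj j k"
    and p_pos: "1 \<le> p"
    and m_pos: "0 < m" and m_less: "m < n"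
    and adj_last: "i < m \<Longrightarrow> \<not> adj i (n - 1)"
    and tail_clique: "\<lbrakk>m \<le> i; i < j; j < n\<rbrakk> \<Longrightarrow> adj i j"
    and scattering: "\<lbrakk>T \<noteq> {}; T \<subseteq> {..<m}; S \<subseteq> {..<n - 1}; S \<inter> T = {};
        \<And>t c. \<lbrakk>t \<in> T; t < c; c < n; adj t c\<rbrakk> \<Longrightarrow> c \<in> S\<rbrakk> \<Longrightarrow> card T + p \<le> card S + 1"
begin

section \<open>The scan: certificates and the invariant\<close>

definition later_nbrs :: "nat \<Rightarrow> nat set" where
  "later_nbrs t = {c. t < c \<and> c < n \<and> adj t c}"

lemma later_nbrs_bound: "t < m \<Longrightarrow> c \<in> later_nbrs t \<Longrightarrow> c < n - 1"
  using adj_last[of t] by (cases "c = n - 1") (auto simp: later_nbrs_def)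

lemma later_nbrs_mono: "\<lbrakk>s \<le> t; c \<in> later_nbrs s; t < c\<rbrakk> \<Longrightarrow> c \<in> later_nbrs t"
  using adj_umbrella[of s t c] by (cases "s = t") (auto simp: later_nbrs_def)

text \<open>
  After the vertices below \<open>t\<close> have been scanned, \<open>X\<close> is the set of used vertices and \<open>E\<close> the set of
  strand ends. A certificate \<open>(T, S)\<close> for \<open>\<theta>\<close> is prepared for the event that the scan gets stuck at
  \<open>\<theta>\<close>: then all later neighbours of \<open>insert \<theta> T\<close> lie in \<open>S\<close>, which is too small.
\<close>

definition certificate :: "nat \<Rightarrow> nat set \<Rightarrow> nat \<Rightarrow> nat set \<Rightarrow> nat set \<Rightarrow> bool" where
  "certificate t X \<theta> T S \<longleftrightarrow> T \<noteq> {} \<and> T \<subseteq> {..<t} \<and> S \<subseteq> X \<and> S \<inter> T = {} \<and> \<theta> \<notin> S \<and>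
     card S + 1 \<le> card T + p \<and> X \<inter> {\<theta><..} \<subseteq> S \<and>
     (\<forall>s\<in>T. later_nbrs s \<inter> X \<subseteq> S \<and> later_nbrs s - X \<subseteq> {\<theta><..})"

text \<open>
  The penultimate conjunct of the invariant holds because a strand end only becomes an inner vertex
  before being scanned if it was the smallest end; it is what keeps \<open>\<theta>\<close> out of its certificate.
\<close>

definition greedy_inv :: "nat \<Rightarrow> nat set \<Rightarrow> nat set \<Rightarrow> bool" where
  "greedy_inv t X E \<longleftrightarrow> 0 < t \<and> E \<subseteq> X \<and> card E = p \<and> E \<subseteq> {t..} \<and> {..<t} \<subseteq> X \<and> X \<subseteq> {..<n - 1} \<and>
     (\<forall>x\<in>X. t \<le> x \<longrightarrow> adj (t - 1) x) \<and>
     (\<forall>z\<in>X - E. t \<le> z \<longrightarrow> (\<forall>a\<in>E. \<forall>b\<in>E. a < z \<and> b < z \<longrightarrow> a = b)) \<and>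
     (\<forall>\<theta>\<ge>t. (\<theta> \<in> E \<or> \<theta> \<notin> X) \<and> p \<le> card (X \<inter> {\<theta><..}) \<longrightarrow> (\<exists>T S. certificate t X \<theta> T S))"

lemma greedy_invD:
  assumes "greedy_inv t X E"
  shows "0 < t" "E \<subseteq> X" "card E = p" "E \<subseteq> {t..}" "{..<t} \<subseteq> X" "X \<subseteq> {..<n - 1}"
    "\<lbrakk>x \<in> X; t \<le> x\<rbrakk> \<Longrightarrow> adj (t - 1) x"
    "\<lbrakk>z \<in> X; z \<notin> E; t \<le> z; a \<in> E; b \<in> E; a < z; b < z\<rbrakk> \<Longrightarrow> a = b"
    "\<lbrakk>t \<le> \<theta>; \<theta> \<in> E \<or> \<theta> \<notin> X; p \<le> card (X \<inter> {\<theta><..})\<rbrakk> \<Longrightarrow> \<exists>T S. certificate t X \<theta> T S"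
  using assms[unfolded greedy_inv_def] by simp_all

lemma greedy_inv_finite: "greedy_inv t X E \<Longrightarrow> finite X \<and> finite E"
  unfolding greedy_inv_def by (meson finite_lessThan finite_subset)

lemma greedy_inv_adj:
  assumes "greedy_inv t X E" "x \<in> X" "t < x"
  shows "adj t x"
proof -
  have "adj (t - 1) x" "x < n" "0 < t"
    using assms unfolding greedy_inv_def by (auto simp: subset_iff)
  then show ?thesis using adj_umbrella[of "t - 1" t x] assms(3) by auto
qed

lemma greedy_inv_skip:
  assumes inv: "greedy_inv t X E" and t: "t \<in> X" "t \<notin> E"
  shows "greedy_inv (Suc t) X E"
proof -
  have "\<exists>T S. certificate (Suc t) X \<theta> T S"
    if "Suc t \<le> \<theta>" "\<theta> \<in> E \<or> \<theta> \<notin> X" "p \<le> card (X \<inter> {\<theta><..})" for \<theta>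
  proof -
    have "\<exists>T S. certificate t X \<theta> T S" using inv that unfolding greedy_inv_def by auto
    then obtain T S where "certificate t X \<theta> T S" by blast
    then have "certificate (Suc t) X \<theta> T S" unfolding certificate_def by (auto simp: less_Suc_eq)
    then show ?thesis by blast
  qed
  moreover have "E \<subseteq> {Suc t..}"
  proof
    fix x assume "x \<in> E"
    then have "t \<le> x" "x \<noteq> t" using inv t unfolding greedy_inv_def by auto
    then show "x \<in> {Suc t..}" by simp
  qed
  moreover have "{..<Suc t} \<subseteq> X" using inv t unfolding greedy_inv_def by (auto simp: less_Suc_eq)
  moreover have "\<forall>x\<in>X. Suc t \<le> x \<longrightarrow> adj t x" using greedy_inv_adj[OF inv] by auto
  ultimately show ?thesis using inv unfolding greedy_inv_def by auto
qed

lemma greedy_inv_not_stuck: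
  assumes inv: "greedy_inv t X E" and t: "t < m" "t \<in> E \<or> t \<notin> X"
  shows "later_nbrs t - X \<noteq> {}"
proof
  assume stuck: "later_nbrs t - X = {}"
  have finX: "finite X" using greedy_inv_finite[OF inv] by simp
  have X: "X \<subseteq> {..<n - 1}" using inv by (simp add: greedy_inv_def)
  show False
  proof (cases "p \<le> card (X \<inter> {t<..})")
    case True
    then obtain T S where c: "certificate t X t T S" using greedy_invD(9)[OF inv, of t] t(2) by auto
    then have TS: "T \<subseteq> {..<t}" "S \<subseteq> X" "S \<inter> T = {}" "t \<notin> S" "card S + 1 \<le> card T + p"
      "X \<inter> {t<..} \<subseteq> S" "\<And>s. s \<in> T \<Longrightarrow> later_nbrs s \<inter> X \<subseteq> S" "\<And>s. s \<in> T \<Longrightarrow> later_nbrs s - X \<subseteq> {t<..}"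
      unfolding certificate_def by auto
    have in_S: "c \<in> S" if "s \<in> insert t T" "c \<in> later_nbrs s" for s c
    proof (cases "c \<in> X")
      case True
      then show ?thesis using that TS(6,7) by (auto simp: later_nbrs_def)
    next
      case False
      then have "s \<in> T" using that stuck by auto
      then have "t < c" "s \<le> t" using TS(1,8) that False by auto
      then have "c \<in> later_nbrs t" using later_nbrs_mono that(2) by blast
      then show ?thesis using stuck False by blast
    qed
    have "card (insert t T) + p \<le> card S + 1"
    proof (rule scattering)
      show "insert t T \<subseteq> {..<m}" using TS(1) t(1) by auto
      show "S \<subseteq> {..<n - 1}" using TS(2) X by blast
      show "S \<inter> insert t T = {}" using TS(3,4) by blast
      show "c \<in> S" if "s \<in> insert t T" "s < c" "c < n" "adj s c" for s c
        using in_S[OF that(1)] that by (auto simp: later_nbrs_def)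
    qed auto
    moreover have "card (insert t T) = Suc (card T)"
      using TS(1) finite_subset by (subst card_insert_disjoint) auto
    ultimately show False using TS(5) by simp
  next
    case False
    have sub: "later_nbrs t \<subseteq> X \<inter> {t<..}" using stuck by (auto simp: later_nbrs_def)
    have "card {t} + p \<le> card (later_nbrs t) + 1"
    proof (rule scattering)
      show "later_nbrs t \<subseteq> {..<n - 1}" using sub X by auto
    qed (use t in \<open>auto simp: later_nbrs_def\<close>)
    moreover have "card (later_nbrs t) \<le> card (X \<inter> {t<..})"
      using sub finX by (intro card_mono) auto
    ultimately show False using False by simp
  qed
qed

lemma greedy_inv_extend:
  assumes inv: "greedy_inv t X E" and t: "t < m"
    and x: "t \<in> E \<and> x = t \<or> t \<notin> X \<and> x = Min E"
    and w: "w \<in> later_nbrs t - X" and w_min: "\<And>y. y \<in> later_nbrs t - X \<Longrightarrow> w \<le> y"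
  shows "greedy_inv (Suc t) (X \<union> {t, w}) (insert w (E - {x}))"
proof -
  define X' where "X' = X \<union> {t, w}"
  define E' where "E' = insert w (E - {x})"
  have fin: "finite X" "finite E" using greedy_inv_finite[OF inv] by auto
  note E = greedy_invD(2-4)[OF inv] and X = greedy_invD(5,6)[OF inv]
    and single = greedy_invD(8)[OF inv] and certificate = greedy_invD(9)[OF inv]
  have E_ne: "E \<noteq> {}" using E(2) p_pos by auto
  have xE: "x \<in> E" using x Min_in[OF fin(2) E_ne] by blast
  have x_le: "x \<le> a" if "a \<in> E" for a
    using x that E(3) fin(2) by auto
  have w': "t < w" "w < n - 1" "w \<notin> X" "adj t w"
    using w later_nbrs_bound[OF t, of w] by (auto simp: later_nbrs_def)
  have wE: "w \<notin> E" using w' E by blast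
  have cardE': "card E' = p"
  proof -
    have "card E' = Suc (card (E - {x}))" unfolding E'_def using fin wE by simp
    also have "\<dots> = card E" by (rule card_Suc_Diff1[OF fin(2) xE])
    finally show ?thesis using E(2) by simp
  qed
  have E'_sub: "E' \<subseteq> {Suc t..}"
  proof
    fix a assume "a \<in> E'"
    then consider "a = w" | "a \<in> E" "a \<noteq> x" unfolding E'_def by blast
    then show "a \<in> {Suc t..}"
    proof cases
      case 2
      then have "t \<le> a" "a \<noteq> t" using E x by auto
      then show ?thesis by simp
    qed (use w' in simp)
  qed
  have single': "a = b" if "z \<in> X'" "z \<notin> E'" "Suc t \<le> z" "a \<in> E'" "b \<in> E'" "a < z" "b < z" for z a b
  proof -
    \<comment> \<open>Only the new end \<open>w\<close> can lie below \<open>z\<close>: either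
      \<open>z\<close> is \<open>x\<close>, the smallest old end, or \<open>z\<close> was already an
      inner vertex and would have the two ends \<open>c\<close> and \<open>x\<close> below
      it.\<close>
    have no: False if "c \<in> E" "c \<noteq> x" "c < z" for c
    proof (cases "z = x")
      case True
      then show False using x_le that by force
    next
      case False
      then have "z \<in> X" "z \<notin> E" using \<open>z \<in> X'\<close> \<open>z \<notin> E'\<close> \<open>Suc t \<le> z\<close> by (auto simp: X'_def E'_def)
      moreover have "x < z" using x_le[OF that(1)] that(3) by simp
      ultimately show False using single[of z c x] that xE \<open>Suc t \<le> z\<close> by auto
    qed
    show ?thesis using no that(4-7) unfolding E'_def by blast
  qed
  have certificate': "\<exists>T S. certificate (Suc t) X' \<theta> T S"
    if \<theta>: "Suc t \<le> \<theta>" "\<theta> \<in> E' \<or> \<theta> \<notin> X'" "p \<le> card (X' \<inter> {\<theta><..})" for \<theta>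
  proof -
    \<comment> \<open>A used \<open>\<theta>\<close> would be an old end other than
      \<open>x\<close>. The remaining \<open>p - 1\<close> ends cannot be all of the used vertices
      beyond it, so an inner vertex would lie beyond both \<open>\<theta>\<close> and
      \<open>x\<close>.\<close>
    have \<theta>X: "\<theta> \<notin> X"
    proof
      assume "\<theta> \<in> X"
      then have \<theta>E: "\<theta> \<in> E" "\<theta> \<noteq> x" "\<theta> \<in> E'" using \<theta>(2) w'(3) by (auto simp: X'_def E'_def)
      have "\<not> X' \<inter> {\<theta><..} \<subseteq> E' - {\<theta>}"
      proof
        assume "X' \<inter> {\<theta><..} \<subseteq> E' - {\<theta>}"
        then have "card (X' \<inter> {\<theta><..}) \<le> card (E' - {\<theta>})"
          using fin by (intro card_mono) (auto simp: E'_def)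
        also have "\<dots> < card E'" using \<theta>E fin by (intro psubset_card_mono) (auto simp: E'_def)
        finally show False using \<theta>(3) cardE' by simp
      qed
      then obtain z where z: "z \<in> X'" "z > \<theta>" "z \<notin> E'" by auto
      show False
      proof (cases "z = x")
        case True
        then show False using x_le[OF \<theta>E(1)] z by simp
      next
        case False
        then have "z \<in> X" "z \<notin> E" using z \<theta>(1) by (auto simp: X'_def E'_def)
        moreover have "x < z" using x_le[OF \<theta>E(1)] z by simp
        ultimately show False using single[of z \<theta> x] \<theta>E xE z \<theta>(1) by auto
      qed
    qed
    show ?thesis
    proof (cases "w \<le> \<theta>")
      case True
      then have eq: "X' \<inter> {\<theta><..} = X \<inter> {\<theta><..}" using \<theta>(1) by (auto simp: X'_def)
      then obtain T S where c: "certificate t X \<theta> T S" using certificate[of \<theta>] \<theta> \<theta>X by auto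
      have "later_nbrs s \<inter> X' \<subseteq> S \<and> later_nbrs s - X' \<subseteq> {\<theta><..}" if "s \<in> T" for s
      proof -
        have "later_nbrs s \<inter> X \<subseteq> S" "later_nbrs s - X \<subseteq> {\<theta><..}" using c that by (auto simp: certificate_def)
        then show ?thesis using True \<theta>(1) by (fastforce simp: X'_def)
      qed
      moreover have "T \<noteq> {}" "T \<subseteq> {..<Suc t}" "S \<subseteq> X'" "S \<inter> T = {}" "\<theta> \<notin> S"
        "card S + 1 \<le> card T + p" "X' \<inter> {\<theta><..} \<subseteq> S"
        using c unfolding certificate_def eq by (auto simp: X'_def)
      ultimately have "certificate (Suc t) X' \<theta> T S" unfolding certificate_def by blast
      then show ?thesis by blast
    next
      case False
      then have \<theta>w: "\<theta> < w" by simp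
      have new: "later_nbrs t - X' \<subseteq> {\<theta><..}"
      proof
        fix c assume "c \<in> later_nbrs t - X'"
        then have "w \<le> c" using w_min[of c] by (auto simp: X'_def)
        then show "c \<in> {\<theta><..}" using \<theta>w by simp
      qed
      show ?thesis
      \<comment> \<open>With at least \<open>p\<close> used vertices beyond \<open>t\<close>, the
        certificate for \<open>t\<close> grows by \<open>t\<close> on one side and \<open>w\<close>
        on the other. Otherwise \<open>{t}\<close> starts a new one, as those vertices and
        \<open>w\<close> together number at most \<open>p\<close>.\<close>
      proof (cases "p \<le> card (X \<inter> {t<..})")
        case True
        have "t \<in> E \<or> t \<notin> X" using x by blast
        then obtain T S where c: "certificate t X t T S" using certificate[of t] True by blast
        have TS: "T \<noteq> {}" "T \<subseteq> {..<t}" "S \<subseteq> X" "S \<inter> T = {}" "t \<notin> S" "card S + 1 \<le> card T + p"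
          "X \<inter> {t<..} \<subseteq> S" "\<And>s. s \<in> T \<Longrightarrow> later_nbrs s \<inter> X \<subseteq> S" "\<And>s. s \<in> T \<Longrightarrow> later_nbrs s - X \<subseteq> {t<..}"
          using c unfolding certificate_def by auto
        have "later_nbrs s \<inter> X' \<subseteq> insert w S \<and> later_nbrs s - X' \<subseteq> {\<theta><..}" if s: "s \<in> insert t T" for s
        proof (intro conjI subsetI)
          fix c assume a: "c \<in> later_nbrs s \<inter> X'"
          show "c \<in> insert w S"
          proof (cases "s = t")
            case True
            then show ?thesis using a TS(7) by (auto simp: X'_def later_nbrs_def)
          next
            case False
            then have "s \<in> T" using s by simp
            then show ?thesis using a TS(8,9)[of s] by (auto simp: X'_def)
          qed
        next
          fix c assume a: "c \<in> later_nbrs s - X'"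
          have "c \<in> later_nbrs t"
          proof (cases "s = t")
            case False
            then have "s \<in> T" using s by simp
            then have "s \<le> t" "t < c" using TS(2) TS(9)[of s] a by (auto simp: X'_def)
            then show ?thesis using a later_nbrs_mono by blast
          qed (use a in simp)
          then show "c \<in> {\<theta><..}" using new a by blast
        qed
        moreover have "card (insert w S) + 1 \<le> card (insert t T) + p"
        proof -
          have "t \<notin> T" "finite T" using TS(2) finite_subset by auto
          then have "card (insert t T) = Suc (card T)" by simp
          moreover have "card (insert w S) \<le> Suc (card S)" by (rule card_insert_le_m1) auto
          ultimately show ?thesis using TS(6) by simp
        qed
        moreover have "X' \<inter> {\<theta><..} \<subseteq> insert w S" using TS(7) \<theta>(1) by (auto simp: X'_def)
        moreover have "insert w S \<inter> insert t T = {}" using TS(2,4,5) w'(1) by auto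
        moreover have "insert t T \<subseteq> {..<Suc t}" using TS(2) by auto
        moreover have "insert w S \<subseteq> X'" "\<theta> \<notin> insert w S" using TS(3) \<theta>X \<theta>w by (auto simp: X'_def)
        ultimately have "certificate (Suc t) X' \<theta> (insert t T) (insert w S)" unfolding certificate_def by blast
        then show ?thesis by blast
      next
        case False
        define S where "S = insert w (X \<inter> {t<..})"
        have "card S \<le> p"
          using False fin w' unfolding S_def by (subst card_insert_disjoint) auto
        moreover have "later_nbrs t \<inter> X' \<subseteq> S" by (auto simp: S_def X'_def later_nbrs_def)
        moreover have "X' \<inter> {\<theta><..} \<subseteq> S" "\<theta> \<notin> S" "S \<subseteq> X'" "S \<inter> {t} = {}"
          using \<theta>(1) \<theta>X \<theta>w w'(1) by (auto simp: S_def X'_def)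
        ultimately have "certificate (Suc t) X' \<theta> {t} S" using new unfolding certificate_def by auto
        then show ?thesis by blast
      qed
    qed
  qed
  have "E' \<subseteq> X'" using E by (auto simp: E'_def X'_def)
  moreover have "{..<Suc t} \<subseteq> X'" using X by (auto simp: X'_def less_Suc_eq)
  moreover have "X' \<subseteq> {..<n - 1}" using X w' t m_less by (auto simp: X'_def)
  moreover have "\<forall>y\<in>X'. Suc t \<le> y \<longrightarrow> adj t y" using greedy_inv_adj[OF inv] w' by (auto simp: X'_def)
  ultimately have "greedy_inv (Suc t) X' E'"
    using cardE' E'_sub single' certificate' unfolding greedy_inv_def by auto
  then show ?thesis by (simp add: X'_def E'_def)
qed

text \<open>If \<open>p\<close> used vertices lie beyond \<open>\<theta>\<close>, they are all of
  \<open>Y\<close>; the other neighbours of \<open>0\<close> are larger still, so \<open>{0}\<close>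
  and \<open>Y\<close> form a certificate.\<close>

lemma greedy_inv_start:
  assumes Y: "Y \<subseteq> later_nbrs 0" "card Y = p" and Y_min: "\<And>y z. \<lbrakk>y \<in> Y; z \<in> later_nbrs 0 - Y\<rbrakk> \<Longrightarrow> y < z"
  shows "greedy_inv 1 (insert 0 Y) Y"
proof -
  have finY: "finite Y" using Y(2) p_pos card.infinite by fastforce
  have Y1: "Y \<subseteq> {1..}" "Y \<subseteq> {..<n - 1}" using Y(1) later_nbrs_bound[OF m_pos] by (auto simp: later_nbrs_def)
  have "certificate 1 (insert 0 Y) \<theta> {0} Y"
    if "1 \<le> \<theta>" "p \<le> card (insert 0 Y \<inter> {\<theta><..})" for \<theta>
  proof -
    have "insert 0 Y \<inter> {\<theta><..} = Y"
    proof (rule card_seteq[OF finY])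
      show "card Y \<le> card (insert 0 Y \<inter> {\<theta><..})" using that Y(2) by simp
    qed auto
    then have gt: "Y \<subseteq> {\<theta><..}" by auto
    obtain y where y: "y \<in> Y" using Y(2) p_pos by fastforce
    have "later_nbrs 0 - insert 0 Y \<subseteq> {\<theta><..}"
    proof
      fix z assume "z \<in> later_nbrs 0 - insert 0 Y"
      then have "y < z" using Y_min[OF y] by blast
      then show "z \<in> {\<theta><..}" using gt y by fastforce
    qed
    then show ?thesis using gt Y1 Y(2) that by (auto simp: certificate_def later_nbrs_def)
  qed
  then show ?thesis
    unfolding greedy_inv_def using Y Y1 m_pos m_less by (auto simp: later_nbrs_def)
qed

section \<open>Growing and closing the strands\<close>

lemma ex_smallest_subset:
  fixes A :: "nat set"
  assumes "finite A" "k \<le> card A"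
  shows "\<exists>Y\<subseteq>A. card Y = k \<and> (\<forall>y\<in>Y. \<forall>z\<in>A - Y. y < z)"
  using assms(2)
proof (induction k)
  case 0
  show ?case by (intro exI[of _ "{}"]) auto
next
  case (Suc k)
  then obtain Y where Y: "Y \<subseteq> A" "card Y = k" "\<forall>y\<in>Y. \<forall>z\<in>A - Y. y < z" by auto
  have finY: "finite Y" using Y(1) assms(1) finite_subset by blast
  have ne: "A - Y \<noteq> {}" using Y(2) Suc.prems finY card_mono[of Y A] by auto
  have fin: "finite (A - Y)" using assms(1) by simp
  let ?a = "Min (A - Y)"
  have a: "?a \<in> A - Y" using Min_in[OF fin ne] .
  have "?a < z" if "z \<in> A - Y" "z \<noteq> ?a" for z
    using Min_le[OF fin that(1)] that(2) by simp
  then have "\<forall>y\<in>insert ?a Y. \<forall>z\<in>A - insert ?a Y. y < z" using Y(3) by blast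
  moreover have "card (insert ?a Y) = Suc k" using a finY Y(2) by simp
  ultimately show ?case using a Y(1) by (intro exI[of _ "insert ?a Y"]) auto
qed

text \<open>The strands are stored backwards: \<open>hd (P i)\<close> is the growing end.\<close>

definition strand_inv :: "nat \<Rightarrow> (nat \<Rightarrow> nat list) \<Rightarrow> bool" where
  "strand_inv t P \<longleftrightarrow> (\<forall>i<p. P i \<noteq> [] \<and> successively adj (P i) \<and> distinct (P i) \<and> last (P i) = 0) \<and>
     (\<forall>i<p. \<forall>j<p. i \<noteq> j \<longrightarrow> set (P i) \<inter> set (P j) \<subseteq> {0}) \<and>
     greedy_inv t (\<Union>i<p. set (P i)) ((\<lambda>i. hd (P i)) ` {..<p})"

lemma ex_strand_inv_start: "\<exists>P. strand_inv 1 P"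
proof -
  \<comment> \<open>The bound for \<open>T = {0}\<close> provides the \<open>p\<close> neighbours
    with which the strands begin.\<close>
  have "card {0::nat} + p \<le> card (later_nbrs 0) + 1"
    by (rule scattering) (use m_pos later_nbrs_bound[OF m_pos] in \<open>auto simp: later_nbrs_def\<close>)
  then have le: "p \<le> card (later_nbrs 0)" by simp
  moreover have "finite (later_nbrs 0)" by (simp add: later_nbrs_def)
  ultimately obtain Y where Y: "Y \<subseteq> later_nbrs 0" "card Y = p" "\<forall>y\<in>Y. \<forall>z\<in>later_nbrs 0 - Y. y < z"
    using ex_smallest_subset by meson
  then have inv: "greedy_inv 1 (insert 0 Y) Y" using greedy_inv_start by blast
  have "finite Y" using greedy_inv_finite[OF inv] by simp
  then obtain f where f: "bij_betw f {..<p} Y"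
    using ex_bij_betw_nat_finite[of Y] Y(2) by (auto simp: atLeast0LessThan)
  define P where "P i = [f i, 0]" for i
  have fY: "f i \<in> later_nbrs 0" if "i < p" for i using f Y(1) that by (auto simp: bij_betw_def)
  have inj: "f i \<noteq> f j" if "i < p" "j < p" "i \<noteq> j" for i j
    using f that by (auto simp: bij_betw_def inj_on_def)
  have "0 < p" using p_pos by simp
  then have "(\<Union>i<p. set (P i)) = insert 0 Y" "(\<lambda>i. hd (P i)) ` {..<p} = Y"
    using f by (auto simp: P_def bij_betw_def)
  moreover have "\<forall>i<p. P i \<noteq> [] \<and> successively adj (P i) \<and> distinct (P i) \<and> last (P i) = 0"
    using fY adj_sym[of 0] by (auto simp: P_def later_nbrs_def)
  moreover have "\<forall>i<p. \<forall>j<p. i \<noteq> j \<longrightarrow> set (P i) \<inter> set (P j) \<subseteq> {0}"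
    using inj by (auto simp: P_def)
  ultimately have "strand_inv 1 P" using inv by (simp add: strand_inv_def)
  then show ?thesis by blast
qed

lemma ex_strand_inv_step:
  assumes inv: "strand_inv t P" and t: "t < m"
  shows "\<exists>P. strand_inv (Suc t) P"
proof -
  define X where "X = (\<Union>i<p. set (P i))"
  define E where "E = (\<lambda>i. hd (P i)) ` {..<p}"
  have greedy_inv: "greedy_inv t X E" using inv by (simp add: strand_inv_def X_def E_def)
  show ?thesis
  proof (cases "t \<in> X \<and> t \<notin> E")
    case True
    then have "strand_inv (Suc t) P" using inv greedy_inv_skip[OF greedy_inv] by (auto simp: strand_inv_def X_def E_def)
    then show ?thesis by blast
  next
    case False
    have P: "\<And>i. i < p \<Longrightarrow> P i \<noteq> [] \<and> successively adj (P i) \<and> distinct (P i) \<and> last (P i) = 0"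
      and disj: "\<And>i j. \<lbrakk>i < p; j < p; i \<noteq> j\<rbrakk> \<Longrightarrow> set (P i) \<inter> set (P j) \<subseteq> {0}"
      using inv by (auto simp: strand_inv_def)
    define x where "x = (if t \<in> E then t else Min E)"
    have fin: "finite E" and "E \<noteq> {}" using p_pos by (auto simp: E_def lessThan_empty_iff)
    then have xE: "x \<in> E" using Min_in by (auto simp: x_def)
    have x_cases: "t \<in> E \<and> x = t \<or> t \<notin> X \<and> x = Min E" using False by (auto simp: x_def)
    have tx: "t \<le> x" "x \<in> X" using greedy_invD(2,4)[OF greedy_inv] xE by auto
    have "later_nbrs t - X \<noteq> {}" using greedy_inv_not_stuck[OF greedy_inv t] False by blast
    moreover have fin: "finite (later_nbrs t - X)" by (simp add: later_nbrs_def)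
    ultimately have w: "Min (later_nbrs t - X) \<in> later_nbrs t - X" using Min_in by blast
    define w where "w = Min (later_nbrs t - X)"
    have w: "w \<in> later_nbrs t - X" and w_min: "\<And>y. y \<in> later_nbrs t - X \<Longrightarrow> w \<le> y"
      using w Min_le[OF fin] by (auto simp: w_def)
    have greedy_inv': "greedy_inv (Suc t) (X \<union> {t, w}) (insert w (E - {x}))"
      by (rule greedy_inv_extend[OF greedy_inv t x_cases w w_min])
    obtain i where i: "i < p" "hd (P i) = x" using xE by (auto simp: E_def)
    \<comment> \<open>Strands share only the vertex \<open>0\<close>, so the positive vertices
      \<open>t\<close> and \<open>x\<close> each lie on at most one strand.\<close>
    have t0: "0 < t" by (rule greedy_invD(1)[OF greedy_inv])
    have wt: "t < w" "adj t w" "w \<notin> X" using w by (auto simp: later_nbrs_def)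
    define Q where "Q = (if x = t then P i else t # P i)"
    define P' where "P' = P(i := w # Q)"
    have hd_Q: "hd Q = t" "Q \<noteq> []" using i P by (auto simp: Q_def)
    have adj_tx: "adj t x" if "x \<noteq> t" using greedy_inv_adj[OF greedy_inv tx(2)] tx(1) that by simp
    have notin: "t \<notin> X" if "x \<noteq> t" using x_cases that by blast
    have Pi: "set (P i) \<subseteq> X" using i by (auto simp: X_def)
    have set_Q: "set Q = insert t (set (P i))"
    proof -
      have "hd (P i) \<in> set (P i)" using P[OF i(1)] hd_in_set by blast
      then show ?thesis using i by (auto simp: Q_def)
    qed
    have Q: "successively adj Q" "distinct Q" "last Q = 0"
      using P[OF i(1)] i adj_tx notin Pi by (auto simp: Q_def successively_Cons)
    have wQ: "w \<notin> set Q" using wt Pi set_Q by auto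
    have 1: "P' k \<noteq> [] \<and> successively adj (P' k) \<and> distinct (P' k) \<and> last (P' k) = 0" if "k < p" for k
      using P[OF that] Q hd_Q wQ adj_sym[OF wt(2)] by (auto simp: P'_def successively_Cons)
    have new: "set (P' i) \<inter> set (P k) \<subseteq> {0}" if "k < p" "k \<noteq> i" for k
    proof -
      have "set (P k) \<subseteq> X" using that by (auto simp: X_def)
      then have "w \<notin> set (P k)" using wt by blast
      moreover have "t \<notin> set (P k)"
      proof (cases "x = t")
        case True
        then have "t \<in> set (P i)" using set_Q unfolding Q_def by auto
        then show ?thesis using disj[OF i(1) that(1)] that(2) t0 by auto
      qed (use notin \<open>set (P k) \<subseteq> X\<close> in blast)
      ultimately show ?thesis using disj[OF i(1) that(1)] that(2) set_Q by (auto simp: P'_def)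
    qed
    have 2: "set (P' k) \<inter> set (P' l) \<subseteq> {0}" if "k < p" "l < p" "k \<noteq> l" for k l
    proof -
      consider "k = i" | "l = i" | "k \<noteq> i" "l \<noteq> i" by blast
      then show ?thesis
      proof cases
        case 1
        then show ?thesis using new[of l] that by (simp add: P'_def)
      next
        case 2
        then show ?thesis using new[of k] that by (auto simp: P'_def)
      next
        case 3
        then show ?thesis using disj that by (simp add: P'_def)
      qed
    qed
    have upd: "(\<Union>k<p. set (P' k)) = X \<union> {t, w}"
    proof -
      have "(\<Union>k<p. set (P' k)) = set (P' i) \<union> (\<Union>k\<in>{..<p} - {i}. set (P' k))" using i(1) by auto
      also have "\<dots> = set (P i) \<union> {t, w} \<union> (\<Union>k\<in>{..<p} - {i}. set (P k))"
        using set_Q by (auto simp: P'_def)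
      also have "\<dots> = X \<union> {t, w}" using i(1) by (auto simp: X_def)
      finally show ?thesis .
    qed
    have "hd (P k) \<noteq> x" if "k < p" "k \<noteq> i" for k
    proof
      assume "hd (P k) = x"
      then have "x \<in> set (P k)" "x \<in> set (P i)" using P[OF that(1)] P[OF i(1)] i(2) hd_in_set by metis+
      then show False using disj[OF that(1) i(1) that(2)] tx t0 by auto
    qed
    then have "(\<lambda>k. hd (P k)) ` ({..<p} - {i}) = E - {x}" using i by (auto simp: E_def)
    moreover have "(\<lambda>k. hd (P' k)) ` {..<p} = insert w ((\<lambda>k. hd (P k)) ` ({..<p} - {i}))"
    proof -
      have "{..<p} = insert i ({..<p} - {i})" using i(1) by auto
      then have "(\<lambda>k. hd (P' k)) ` {..<p} = insert (hd (P' i)) ((\<lambda>k. hd (P' k)) ` ({..<p} - {i}))"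
        by (metis image_insert)
      then show ?thesis by (simp add: P'_def)
    qed
    ultimately have "(\<lambda>k. hd (P' k)) ` {..<p} = insert w (E - {x})" by simp
    then have "strand_inv (Suc t) P'" using 1 2 upd greedy_inv' by (simp add: strand_inv_def)
    then show ?thesis by blast
  qed
qed

theorem ex_list_stave: "\<exists>Q. list_stave adj {..<n} p 0 (n - 1) Q"
proof -
  have "\<exists>P. strand_inv t P" if "1 \<le> t" "t \<le> m" for t
    using that
  proof (induction t rule: dec_induct)
    case base
    show ?case by (rule ex_strand_inv_start)
  next
    case (step t)
    then show ?case using ex_strand_inv_step[of t] by auto
  qed
  then obtain P where inv: "strand_inv m P" using m_pos by fastforce
  have P: "\<And>i. i < p \<Longrightarrow> P i \<noteq> [] \<and> successively adj (P i) \<and> distinct (P i) \<and> last (P i) = 0"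
    and disj: "\<And>i j. \<lbrakk>i < p; j < p; i \<noteq> j\<rbrakk> \<Longrightarrow> set (P i) \<inter> set (P j) \<subseteq> {0}"
    and greedy_inv: "greedy_inv m (\<Union>i<p. set (P i)) ((\<lambda>i. hd (P i)) ` {..<p})"
    using inv by (auto simp: strand_inv_def)
  note used = greedy_invD(5,6)[OF greedy_inv] and ends = greedy_invD(4)[OF greedy_inv]
  define R where "R = sorted_list_of_set ({m..<n - 1} - (\<Union>i<p. set (P i)))"
  have R: "set R = {m..<n - 1} - (\<Union>i<p. set (P i))" "distinct R" by (auto simp: R_def)
  have succ: "successively adj xs" if "distinct xs" "set xs \<subseteq> {m..<n}" for xs
    using that
  proof (induction xs)
    case (Cons a xs)
    show ?case
    proof (cases xs)
      case (Cons b ys)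
      then have "a \<noteq> b" "m \<le> a" "a < n" "m \<le> b" "b < n" using Cons.prems by auto
      then have "adj a b" using tail_clique[of a b] tail_clique[of b a] adj_sym by (cases "a < b") auto
      then show ?thesis using Cons.IH Cons.prems Cons by simp
    qed simp
  qed simp
  define B where "B i = (n - 1) # (if i = 0 then R else []) @ P i" for i
  have B: "successively adj (B i) \<and> distinct (B i)" if "i < p" for i
  proof -
    define L where "L = (n - 1) # (if i = 0 then R else [])"
    have Pi: "set (P i) \<subseteq> (\<Union>i<p. set (P i))" using that by blast
    have hdP: "hd (P i) \<in> set (P i)" using P[OF that] by simp
    have "m \<le> hd (P i)" using ends that by auto
    moreover have "hd (P i) < n - 1" using hdP Pi used by auto
    ultimately have "successively adj (L @ [hd (P i)])"
      using R Pi hdP m_less by (intro succ) (auto simp: L_def)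
    moreover have "n - 1 \<notin> set (P i)" using Pi used(2) by blast
    then have "distinct (B i)" using P[OF that] R Pi by (auto simp: B_def)
    moreover have "B i = L @ P i" by (simp add: B_def L_def)
    ultimately show ?thesis using P[OF that] by (auto simp: successively_append_iff)
  qed
  have B_disj: "set (B i) \<inter> set (B j) \<subseteq> {0, n - 1}" if "i < p" "j < p" "i \<noteq> j" for i j
  proof -
    have "set R \<inter> set (P k) = {}" if "k < p" for k using R that by auto
    then show ?thesis using disj[OF that] that by (auto simp: B_def)
  qed
  have B_span: "(\<Union>i<p. set (B i)) = {..<n}"
  proof
    show "(\<Union>i<p. set (B i)) \<subseteq> {..<n}"
    proof
      fix c assume "c \<in> (\<Union>i<p. set (B i))"
      then have "c = n - 1 \<or> c \<in> {m..<n - 1} \<or> c \<in> (\<Union>i<p. set (P i))"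
        using R by (auto simp: B_def split: if_splits)
      then show "c \<in> {..<n}" using used m_less by auto
    qed
    show "{..<n} \<subseteq> (\<Union>i<p. set (B i))"
    proof
      fix c assume "c \<in> {..<n}"
      have PB: "(\<Union>i<p. set (P i)) \<subseteq> (\<Union>i<p. set (B i))" by (auto simp: B_def)
      have B0: "insert (n - 1) (set R) \<subseteq> (\<Union>i<p. set (B i))"
      proof -
        have "0 \<in> {..<p}" using p_pos by simp
        then have "set (B 0) \<subseteq> (\<Union>i<p. set (B i))" by blast
        then show ?thesis by (simp add: B_def)
      qed
      consider "c < m" | "c \<in> {m..<n - 1}" | "c = n - 1" using \<open>c \<in> {..<n}\<close> by force
      then show "c \<in> (\<Union>i<p. set (B i))"
      proof cases
        case 1
        then show ?thesis using used(1) PB by blast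
      next
        case 2
        then have "c \<in> (\<Union>i<p. set (P i)) \<or> c \<in> set R" using R(1) by blast
        then show ?thesis using PB B0 by blast
      next
        case 3
        then show ?thesis using B0 by blast
      qed
    qed
  qed
  have "successively adj (rev (B i))" if "i < p" for i
  proof -
    have "(\<lambda>x y. adj y x) = adj" using adj_sym by blast
    then show ?thesis using B[OF that] by (metis successively_rev)
  qed
  moreover have "B i \<noteq> [] \<and> hd (B i) = n - 1 \<and> last (B i) = 0" if "i < p" for i
    using P[OF that] by (simp add: B_def)
  ultimately show ?thesis unfolding list_stave_def using B B_disj B_span
    by (intro exI[of _ "\<lambda>i. rev (B i)"]) (auto simp: hd_rev last_rev)
qed

end

section \<open>Interval orderings\<close>

lemma dominates_induce_iff: "x \<rightarrow>\<^bsub>G \<restriction> W\<^esub> y \<longleftrightarrow> x \<rightarrow>\<^bsub>G\<^esub> y \<and> x \<in> W \<and> y \<in> W"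
  by (auto simp: arcs_ends_conv)

text \<open>The one-sided \<open>umbrella\<close> makes \<open>f 0\<close> simplicial but not
  \<open>f (n - 1)\<close>, whence \<open>last_simplicial\<close>. Adjacent ends would make the
  graph complete, a case treated separately.\<close>

locale interval_ordering = graph G for G :: "('a, 'b) pre_digraph" +
  fixes f :: "nat \<Rightarrow> 'a" and n :: nat
  assumes f_bij: "bij_betw f {..<n} (verts G)"
    and umbrella: "\<lbrakk>i < j; j < k; k < n; f i \<rightarrow>\<^bsub>G\<^esub> f k\<rbrakk> \<Longrightarrow> f j \<rightarrow>\<^bsub>G\<^esub> f k"
    and last_simplicial: "\<lbrakk>x \<rightarrow>\<^bsub>G\<^esub> f (n - 1); y \<rightarrow>\<^bsub>G\<^esub> f (n - 1); x \<noteq> y\<rbrakk> \<Longrightarrow> x \<rightarrow>\<^bsub>G\<^esub> y"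
    and two_le_n: "2 \<le> n"
    and ends_not_adj: "\<not> f 0 \<rightarrow>\<^bsub>G\<^esub> f (n - 1)"
begin

lemma f_in_verts: "i < n \<Longrightarrow> f i \<in> verts G"
  using f_bij by (auto simp: bij_betw_def)

lemma f_eq_iff: "\<lbrakk>i < n; j < n\<rbrakk> \<Longrightarrow> f i = f j \<longleftrightarrow> i = j"
  using f_bij by (auto simp: bij_betw_def inj_on_def)

lemma vertE: "x \<in> verts G \<Longrightarrow> (\<And>i. \<lbrakk>i < n; x = f i\<rbrakk> \<Longrightarrow> thesis) \<Longrightarrow> thesis"
  using f_bij by (auto simp: bij_betw_def)

lemma dom_sym: "x \<rightarrow>\<^bsub>G\<^esub> y \<Longrightarrow> y \<rightarrow>\<^bsub>G\<^esub> x"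
  using graph_symmetric by blast

lemma first_simplicial:
  assumes "f 0 \<rightarrow>\<^bsub>G\<^esub> x" "f 0 \<rightarrow>\<^bsub>G\<^esub> y" "x \<noteq> y"
  shows "x \<rightarrow>\<^bsub>G\<^esub> y"
proof -
  obtain i j where ij: "i < n" "x = f i" "j < n" "y = f j"
    using assms adj_in_verts(2) vertE by metis
  have "x \<noteq> f 0" "y \<noteq> f 0" using assms adj_not_same by blast+
  then have "0 < i" "0 < j" "i \<noteq> j" using ij assms(3) by (auto intro: gr0I)
  then consider "0 < i" "i < j" | "0 < j" "j < i" by linarith
  then show ?thesis
  proof cases
    case 1
    then show ?thesis using umbrella[of 0 i j] assms ij by simp
  next
    case 2
    then show ?thesis using umbrella[of 0 j i] assms ij dom_sym by simp
  qed
qed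

lemma induce_sym: "W \<subseteq> verts G \<Longrightarrow> sym_digraph (G \<restriction> W)"
  by (intro induced_graph_imp_graph induced_induce)

lemma num_components_induce:
  assumes "W \<subseteq> verts G"
  shows "num_components (G \<restriction> W) = card (pre_digraph.scc_of (G \<restriction> W) ` W)"
proof -
  interpret H: sym_digraph "G \<restriction> W" by (rule induce_sym[OF assms])
  show ?thesis by (simp add: num_components_def H.sccs_verts_conv_scc_of)
qed

text \<open>A walk from \<open>f t\<close> with \<open>t \<in> T\<close> that avoids
  \<open>S\<close> cannot pass beyond \<open>t\<close>: by the umbrella property the first vertex
  beyond would be a later neighbour of \<open>f t\<close>, hence in \<open>S\<close>. So
  \<open>n - 1\<close> and the members of \<open>T\<close> represent distinct components.\<close>

lemma card_separated_le_components:
  assumes T: "T \<subseteq> {..<n - 1}" and S: "S \<subseteq> {..<n - 1}" "S \<inter> T = {}"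
    and closed: "\<And>t c. \<lbrakk>t \<in> T; t < c; c < n; f t \<rightarrow>\<^bsub>G\<^esub> f c\<rbrakk> \<Longrightarrow> c \<in> S"
  shows "card T + 1 \<le> num_components (G \<restriction> (verts G - f ` S))"
proof -
  define W where "W = verts G - f ` S"
  interpret H: sym_digraph "G \<restriction> W" by (rule induce_sym) (auto simp: W_def)
  have W_iff: "f i \<in> W \<longleftrightarrow> i \<notin> S" if "i < n" for i
  proof -
    have "f i \<in> f ` S \<longleftrightarrow> i \<in> S" using S(1) that f_eq_iff by fastforce
    then show ?thesis using f_in_verts[OF that] by (simp add: W_def)
  qed
  have stay: "\<exists>l\<le>s. x = f l" if "s \<in> T" "f s \<rightarrow>\<^sup>*\<^bsub>G \<restriction> W\<^esub> x" for s x
    using that(2)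
  proof (induction rule: H.reachable_induct)
    case base
    then show ?case by blast
  next
    case (step x y)
    then obtain l where l: "l \<le> s" "x = f l" by blast
    have xy: "x \<rightarrow>\<^bsub>G\<^esub> y" "y \<in> W" using step by (auto simp: dominates_induce_iff)
    then obtain k where k: "k < n" "y = f k" using W_def vertE by blast
    show ?case
    proof (rule ccontr)
      assume "\<not> ?case"
      then have "\<not> k \<le> s" using k(2) by blast
      then have "s < k" by simp
      then have "f s \<rightarrow>\<^bsub>G\<^esub> f k" using umbrella[of l s k] l k xy by (cases "l = s") auto
      then have "k \<in> S" using closed[OF that(1) \<open>s < k\<close> k(1)] by blast
      then show False using xy(2) W_iff k by blast
    qed
  qed
  define D where "D = insert (n - 1) T"
  have D: "i < n" "f i \<in> W" if "i \<in> D" for i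
  proof -
    show "i < n" using that T two_le_n by (auto simp: D_def)
    then show "f i \<in> W" using W_iff that S by (auto simp: D_def)
  qed
  have sep: "H.scc_of (f s) \<noteq> H.scc_of (f t)" if "s \<in> D" "t \<in> D" "s < t" for s t
  proof
    assume eq: "H.scc_of (f s) = H.scc_of (f t)"
    have sT: "s \<in> T" using that T by (auto simp: D_def)
    have "f t \<in> H.scc_of (f s)" unfolding eq using D[OF that(2)] by (intro H.in_scc_of_self) simp
    then have "f s \<rightarrow>\<^sup>*\<^bsub>G \<restriction> W\<^esub> f t" by (simp add: H.scc_of_def)
    then obtain l where "l \<le> s" "f t = f l" using stay[OF sT] by blast
    then show False using f_eq_iff[of t l] D[OF that(1)] D[OF that(2)] that(3) by simp
  qed
  have "inj_on (\<lambda>i. H.scc_of (f i)) D"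
    using sep by (intro linorder_inj_onI) auto
  then have "card D = card ((\<lambda>i. H.scc_of (f i)) ` D)" by (simp add: card_image)
  also have "\<dots> \<le> card (H.scc_of ` W)"
    using D(2) by (intro card_mono) (auto simp: W_def)
  also have "\<dots> = num_components (G \<restriction> W)"
    by (rule num_components_induce[symmetric]) (auto simp: W_def)
  finally have "card D \<le> num_components (G \<restriction> W)" .
  moreover have "card D = card T + 1"
    unfolding D_def using T finite_subset by (subst card_insert_disjoint) auto
  ultimately show ?thesis by (simp add: W_def)
qed

section \<open>The two directions for interval orderings\<close>

lemma ex_list_stave_if_scattering:
  assumes p: "1 \<le> p"
    and scat: "\<And>S. \<lbrakk>S \<subseteq> verts G; 2 \<le> num_components (G \<restriction> (verts G - S))\<rbrakk> \<Longrightarrow>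
       num_components (G \<restriction> (verts G - S)) + p \<le> card S + 2"
  shows "\<exists>Q. list_stave (\<lambda>x y. x \<rightarrow>\<^bsub>G\<^esub> y) (verts G) p (f 0) (f (n - 1)) Q"
proof -
  \<comment> \<open>The disjunct \<open>i = n - 1\<close> provides a value when the last vertex is
    isolated.\<close>
  define m where "m = (LEAST i. i = n - 1 \<or> f i \<rightarrow>\<^bsub>G\<^esub> f (n - 1))"
  have m: "m = n - 1 \<or> f m \<rightarrow>\<^bsub>G\<^esub> f (n - 1)" unfolding m_def by (rule LeastI) blast
  have m_le: "m \<le> n - 1" unfolding m_def by (rule Least_le) simp
  have below_m: "\<not> f i \<rightarrow>\<^bsub>G\<^esub> f (n - 1)" if "i < m" for i
    using not_less_Least that unfolding m_def by blast
  have m_pos: "0 < m" using m two_le_n ends_not_adj by (intro gr0I) auto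
  have above_m: "f i \<rightarrow>\<^bsub>G\<^esub> f (n - 1)" if "m \<le> i" "i < n - 1" for i
    using m umbrella[of m i "n - 1"] that by (cases "m = i") auto
  interpret greedy_staves n m p "\<lambda>i j. f i \<rightarrow>\<^bsub>G\<^esub> f j"
  proof
    show "f i \<rightarrow>\<^bsub>G\<^esub> f j" if "m \<le> i" "i < j" "j < n" for i j
    proof (cases "j = n - 1")
      case True
      then show ?thesis using above_m that by simp
    next
      case False
      then show ?thesis using last_simplicial[of "f i" "f j"] above_m f_eq_iff that by auto
    qed
    show "card T + p \<le> card S + 1"
      if "T \<noteq> {}" "T \<subseteq> {..<m}" "S \<subseteq> {..<n - 1}" "S \<inter> T = {}"
        "\<And>t c. \<lbrakk>t \<in> T; t < c; c < n; f t \<rightarrow>\<^bsub>G\<^esub> f c\<rbrakk> \<Longrightarrow> c \<in> S" for T S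
    proof -
      have T: "T \<subseteq> {..<n - 1}" using that(2) m_le by auto
      have fin: "finite T" "finite S" using T that(3) finite_subset by auto
      have ge: "card T + 1 \<le> num_components (G \<restriction> (verts G - f ` S))"
        by (rule card_separated_le_components[OF T that(3-5)])
      \<comment> \<open>As \<open>T\<close> is nonempty, there are at least two components and
        \<open>scat\<close> applies.\<close>
      moreover have "0 < card T" using fin that(1) by (simp add: card_gt_0_iff)
      moreover have "f ` S \<subseteq> verts G" using that(3) f_in_verts by auto
      ultimately have "num_components (G \<restriction> (verts G - f ` S)) + p \<le> card (f ` S) + 2"
        by (intro scat) auto
      then show ?thesis using ge card_image_le[OF fin(2), of f] by simp
    qed
  qed (use dom_sym umbrella p m_pos m_le two_le_n below_m in auto)
  obtain Q where "list_stave (\<lambda>i j. f i \<rightarrow>\<^bsub>G\<^esub> f j) {..<n} p 0 (n - 1) Q" using ex_list_stave by blast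
  then show ?thesis using list_stave_map[OF f_bij, of 0 "n - 1"] two_le_n by fastforce
qed

text \<open>Counting along a stave requires a set avoiding both ends, so it is applied to
  \<open>S - {u, v}\<close> with the component labels extended to the ends. This loses no labels and
  does not enlarge the set.\<close>

lemma scattering_if_list_stave:
  assumes Q: "list_stave (\<lambda>x y. x \<rightarrow>\<^bsub>G\<^esub> y) (verts G) p (f 0) (f (n - 1)) Q"
    and S: "S \<subseteq> verts G" and two: "2 \<le> num_components (G \<restriction> (verts G - S))"
  shows "num_components (G \<restriction> (verts G - S)) + p \<le> card S + 2"
proof -
  define u where "u = f 0"
  define v where "v = f (n - 1)"
  define W where "W = verts G - S"
  have WG: "W \<subseteq> verts G" by (auto simp: W_def)
  interpret H: sym_digraph "G \<restriction> W" by (rule induce_sym[OF WG])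
  let ?c = H.scc_of
  have uv: "u \<in> verts G" "v \<in> verts G" "u \<noteq> v" "\<not> u \<rightarrow>\<^bsub>G\<^esub> v" "\<not> v \<rightarrow>\<^bsub>G\<^esub> u"
    using f_in_verts f_eq_iff[of 0 "n - 1"] two_le_n ends_not_adj dom_sym by (auto simp: u_def v_def)
  have c_self: "x \<in> ?c x" if "x \<in> W" for x using that H.in_scc_of_self by simp
  have c_sub: "?c x \<subseteq> W" for x using H.reachable_in_verts by (auto simp: H.scc_of_def)
  have c_adj: "?c x = ?c y" if "x \<in> W" "y \<in> W" "x \<rightarrow>\<^bsub>G\<^esub> y" for x y
    using that by (intro H.scc_of_eq H.scc_ofI_reachable H.reachable_adjI) (simp add: dominates_induce_iff)
  have simplicial: "y \<rightarrow>\<^bsub>G\<^esub> z" if "x \<in> {u, v}" "x \<rightarrow>\<^bsub>G\<^esub> y" "x \<rightarrow>\<^bsub>G\<^esub> z" "y \<noteq> z" for x y z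
    using that first_simplicial last_simplicial dom_sym unfolding u_def v_def by blast
  \<comment> \<open>As \<open>u\<close> and \<open>v\<close> are simplicial, returning them to \<open>G - S\<close> merges no components.\<close>
  define \<kappa> where "\<kappa> x = (if x \<in> W then ?c x else if \<exists>y\<in>W. x \<rightarrow>\<^bsub>G\<^esub> y then ?c (SOME y. y \<in> W \<and> x \<rightarrow>\<^bsub>G\<^esub> y) else {x})" for x
  have \<kappa>_W: "\<kappa> x = ?c x" if "x \<in> W" for x using that by (simp add: \<kappa>_def)
  have \<kappa>_nbr: "\<kappa> x = ?c y" if "x \<in> {u, v}" "y \<in> W" "x \<rightarrow>\<^bsub>G\<^esub> y" for x y
  proof (cases "x \<in> W")
    case True
    then show ?thesis using c_adj that \<kappa>_W by simp
  next
    case False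
    define z where "z = (SOME y. y \<in> W \<and> x \<rightarrow>\<^bsub>G\<^esub> y)"
    have z: "z \<in> W \<and> x \<rightarrow>\<^bsub>G\<^esub> z" unfolding z_def using that by (intro someI) blast
    have "\<kappa> x = ?c z" using False that by (auto simp: \<kappa>_def z_def)
    also have "\<dots> = ?c y" using z that simplicial[of x z y] c_adj[of z y] by (cases "z = y") auto
    finally show ?thesis .
  qed
  have \<kappa>_alone: "\<kappa> x = {x}" if "x \<notin> W" "\<not> (\<exists>y\<in>W. x \<rightarrow>\<^bsub>G\<^esub> y)" for x using that by (auto simp: \<kappa>_def)
  have \<kappa>_other: "\<kappa> x \<noteq> {y}" if "x \<in> {u, v}" "y \<noteq> x" "y \<notin> W" for x y
  proof (cases "x \<in> W")
    case True
    then show ?thesis using \<kappa>_W[OF True] c_self[OF True] that(2) by auto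
  next
    case False
    show ?thesis
    proof (cases "\<exists>z\<in>W. x \<rightarrow>\<^bsub>G\<^esub> z")
      case True
      then obtain z where z: "z \<in> W" "x \<rightarrow>\<^bsub>G\<^esub> z" by blast
      then show ?thesis using \<kappa>_nbr[OF that(1) z] c_self[OF z(1)] that(3) by auto
    next
      case False
      then show ?thesis using \<kappa>_alone \<open>x \<notin> W\<close> that by simp
    qed
  qed
  \<comment> \<open>Equal labels would make \<open>G - S\<close> connected: \<open>f i\<close> and
    \<open>f j\<close> represent the ends in \<open>W\<close>, what precedes \<open>i\<close> or
    follows \<open>j\<close> belongs to their component, and a walk from \<open>f i\<close> to
    \<open>f j\<close> captures what lies between.\<close>
  have \<kappa>_uv: "\<kappa> u \<noteq> \<kappa> v"
  proof
    assume eq: "\<kappa> u = \<kappa> v"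
    \<comment> \<open>A singleton label from outside \<open>W\<close> belongs to one end only, so
      equal labels come from components.\<close>
    have rep: "x \<in> W \<or> (\<exists>y\<in>W. x \<rightarrow>\<^bsub>G\<^esub> y)" if "x \<in> {u, v}" for x
      using \<kappa>_alone[of x] \<kappa>_other[of u v] \<kappa>_other[of v u] eq uv(3) that by auto
    have "\<exists>i<n. f i \<in> W \<and> \<kappa> u = ?c (f i) \<and> (\<forall>k<i. f k \<in> W \<longrightarrow> ?c (f k) = ?c (f i))"
    proof (cases "u \<in> W")
      case True
      then show ?thesis using \<kappa>_W two_le_n by (intro exI[of _ 0]) (auto simp: u_def)
    next
      case False
      then obtain y where y: "y \<in> W" "u \<rightarrow>\<^bsub>G\<^esub> y" using rep by blast
      then obtain i where i: "i < n" "y = f i" using WG vertE by blast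
      have "?c (f k) = ?c (f i)" if "k < i" "f k \<in> W" for k
      proof -
        have "0 < k" using that False by (intro gr0I) (auto simp: u_def)
        then have "f k \<rightarrow>\<^bsub>G\<^esub> f i" using umbrella[of 0 k i] that i y by (simp add: u_def)
        then show ?thesis using c_adj that i y by simp
      qed
      then show ?thesis using i y \<kappa>_nbr[of u y] by auto
    qed
    then obtain i where i: "i < n" "f i \<in> W" "\<kappa> u = ?c (f i)"
      "\<And>k. \<lbrakk>k < i; f k \<in> W\<rbrakk> \<Longrightarrow> ?c (f k) = ?c (f i)" by blast
    have "\<exists>j<n. f j \<in> W \<and> \<kappa> v = ?c (f j) \<and> (\<forall>k. j < k \<and> k < n \<and> f k \<in> W \<longrightarrow> ?c (f k) = ?c (f j))"
    proof (cases "v \<in> W")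
      case True
      then show ?thesis using \<kappa>_W two_le_n by (intro exI[of _ "n - 1"]) (auto simp: v_def)
    next
      case False
      then obtain y where y: "y \<in> W" "v \<rightarrow>\<^bsub>G\<^esub> y" using rep by blast
      then obtain j where j: "j < n" "y = f j" using WG vertE by blast
      have "?c (f k) = ?c (f j)" if "j < k" "k < n" "f k \<in> W" for k
      proof -
        have "k \<noteq> n - 1" using that False by (auto simp: v_def)
        then have "f k \<rightarrow>\<^bsub>G\<^esub> v" using umbrella[of j k "n - 1"] that j y dom_sym by (simp add: v_def)
        then have "\<kappa> v = ?c (f k)" using \<kappa>_nbr[of v "f k"] that dom_sym by simp
        then show ?thesis using \<kappa>_nbr[of v y] y j by simp
      qed
      then show ?thesis using j y \<kappa>_nbr[of v y] by auto
    qed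
    then obtain j where j: "j < n" "f j \<in> W" "\<kappa> v = ?c (f j)"
      "\<And>k. \<lbrakk>j < k; k < n; f k \<in> W\<rbrakk> \<Longrightarrow> ?c (f k) = ?c (f j)" by blast
    have cij: "?c (f i) = ?c (f j)" using i(3) j(3) eq by simp
    then have "f j \<in> ?c (f i)" using c_self[OF j(2)] by simp
    then have reach: "f i \<rightarrow>\<^sup>*\<^bsub>G \<restriction> W\<^esub> f j" by (simp add: H.scc_of_def)
    have "?c w = ?c (f i)" if w: "w \<in> W" for w
    proof -
      obtain k where k: "k < n" "w = f k" using w WG vertE by blast
      \<comment> \<open>A walk that jumps over \<open>w\<close> along an edge makes \<open>w\<close>
        adjacent to the far end of that edge, by the umbrella property.\<close>
      have cross: "(\<exists>l<k. x = f l) \<or> f i \<rightarrow>\<^sup>*\<^bsub>G \<restriction> W\<^esub> w" if "i < k" "f i \<rightarrow>\<^sup>*\<^bsub>G \<restriction> W\<^esub> x" for x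
        using that(2)
      proof (induction rule: H.reachable_induct)
        case base
        then show ?case using that(1) by blast
      next
        case (step x y)
        show ?case
        proof (cases "f i \<rightarrow>\<^sup>*\<^bsub>G \<restriction> W\<^esub> w")
          case False
          then obtain l where l: "l < k" "x = f l" using step by blast
          have xy: "x \<rightarrow>\<^bsub>G\<^esub> y" "y \<in> W" "x \<in> W" using step by (auto simp: dominates_induce_iff)
          obtain l' where l': "l' < n" "y = f l'" using xy WG vertE by blast
          have reach_y: "f i \<rightarrow>\<^sup>*\<^bsub>G \<restriction> W\<^esub> y" using step H.reachable_adj_trans by blast
          consider "l' < k" | "l' = k" | "k < l'" by linarith
          then show ?thesis
          proof cases
            case 3
            then have "w \<rightarrow>\<^bsub>G\<^esub> y" using umbrella[of l k l'] l l' k xy by simp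
            then have "y \<rightarrow>\<^bsub>G \<restriction> W\<^esub> w" using dom_sym xy \<open>w \<in> W\<close> by (simp add: dominates_induce_iff)
            then show ?thesis using reach_y H.reachable_adj_trans by blast
          qed (use l' k reach_y in auto)
        qed simp
      qed
      consider "k < i" | "k = i" | "i < k" "j < k" | "i < k" "k \<le> j" by linarith
      then show ?thesis
      proof cases
        case 1
        then show ?thesis using i(4) k w by simp
      next
        case 2
        then show ?thesis using k by simp
      next
        case 3
        then show ?thesis using j(4)[of k] k w cij by simp
      next
        case 4
        have "\<not> (\<exists>l<k. f j = f l)" using 4 f_eq_iff[OF j(1)] k(1) by auto
        then have "f i \<rightarrow>\<^sup>*\<^bsub>G \<restriction> W\<^esub> w" using cross[OF 4(1) reach] by blast
        then have "w \<in> ?c (f i)" by (rule H.scc_ofI_reachable')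
        then show ?thesis by (rule H.scc_of_eq)
      qed
    qed
    then have "card (?c ` W) \<le> card {?c (f i)}" by (intro card_mono) auto
    then show False using two num_components_induce[OF WG] by (simp add: W_def)
  qed
  define S' where "S' = S - {u, v}"
  have VS': "verts G - S' = W \<union> {u, v}" using uv by (auto simp: S'_def W_def)
  have "card (\<kappa> ` (verts G - S')) + p \<le> card S' + 2"
  proof (rule card_labels_list_stave[OF Q[folded u_def v_def]])
    show "\<kappa> a = \<kappa> b" if "a \<in> verts G - S'" "b \<in> verts G - S'" "a \<rightarrow>\<^bsub>G\<^esub> b" for a b
    proof -
      have ab: "a \<in> W \<union> {u, v}" "b \<in> W \<union> {u, v}" using that VS' by auto
      consider "a \<in> W" "b \<in> W" | "a \<in> {u, v}" "b \<in> W" | "a \<in> W" "b \<in> {u, v}" | "a \<in> {u, v}" "b \<in> {u, v}"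
        using ab by blast
      then show ?thesis
      proof cases
        case 1
        then show ?thesis using c_adj \<kappa>_W that by simp
      next
        case 2
        then show ?thesis using \<kappa>_nbr[of a b] \<kappa>_W that by simp
      next
        case 3
        then show ?thesis using \<kappa>_nbr[of b a] \<kappa>_W that dom_sym by simp
      next
        case 4
        then show ?thesis using that uv by auto
      qed
    qed
  qed (use uv S \<kappa>_uv in \<open>auto simp: S'_def\<close>)
  moreover have "card (?c ` W) \<le> card (\<kappa> ` (verts G - S'))"
    unfolding VS' using \<kappa>_W WG finite_subset[OF WG] by (intro card_mono) (auto simp: image_iff)
  moreover have "card S' \<le> card S"
    unfolding S'_def using S finite_subset[OF S] by (intro card_mono) auto
  ultimately show ?thesis using num_components_induce[OF WG] by (simp add: W_def)
qed

lemma scat_le_iff: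
  "scat G \<le> ereal (2 - real p) \<longleftrightarrow>
    (\<forall>S \<subseteq> verts G. 2 \<le> num_components (G \<restriction> (verts G - S)) \<longrightarrow>
      num_components (G \<restriction> (verts G - S)) + p \<le> card S + 2)"
proof -
  let ?nc = "\<lambda>S. num_components (G \<restriction> (verts G - S))"
  define M where "M = {int (?nc S) - int (card S) | S. S \<subseteq> verts G \<and> ?nc S \<ge> 2}"
  have "M \<subseteq> (\<lambda>S. int (?nc S) - int (card S)) ` Pow (verts G)" by (auto simp: M_def)
  then have fin: "finite M" by (rule finite_subset) simp
  \<comment> \<open>Deleting all vertices but the two nonadjacent ends leaves two components, so the
    maximum is over a nonempty set.\<close>
  have "card {0::nat} + 1 \<le> ?nc (f ` {1..<n - 1})"
  proof (rule card_separated_le_components)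
    show "c \<in> {1..<n - 1}" if "t \<in> {0}" "t < c" "c < n" "f t \<rightarrow>\<^bsub>G\<^esub> f c" for t c
      using that ends_not_adj by (cases "c = n - 1") auto
  qed (use two_le_n in auto)
  then have "2 \<le> ?nc (f ` {1..<n - 1})" by simp
  moreover have "f ` {1..<n - 1} \<subseteq> verts G" using f_in_verts by auto
  ultimately have "int (?nc (f ` {1..<n - 1})) - int (card (f ` {1..<n - 1})) \<in> M"
    unfolding M_def by blast
  then have ne: "M \<noteq> {}" by blast
  have "(f 0, f (n - 1)) \<notin> arcs_ends G" "f 0 \<noteq> f (n - 1)" "f 0 \<in> verts G" "f (n - 1) \<in> verts G"
    using ends_not_adj f_eq_iff[of 0 "n - 1"] f_in_verts two_le_n by auto
  then have "\<not> complete_digraph (card (verts G)) G" by (auto simp: complete_digraph_def)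
  then have "scat G = ereal (of_int (Max M))" by (simp add: scat_def M_def)
  then have "scat G \<le> ereal (2 - real p) \<longleftrightarrow> Max M \<le> 2 - int p" by simp linarith
  also have "\<dots> \<longleftrightarrow> (\<forall>a\<in>M. a \<le> 2 - int p)" using fin ne by (rule Max_le_iff)
  also have "\<dots> \<longleftrightarrow> (\<forall>S \<subseteq> verts G. 2 \<le> ?nc S \<longrightarrow> ?nc S + p \<le> card S + 2)"
    by (auto simp: M_def; force)
  finally show ?thesis .
qed

theorem ex_spanning_stave_iff_scat:
  assumes "1 \<le> p"
  shows "(\<exists>Ps. spanning_stave G p (f 0) (f (n - 1)) Ps) \<longleftrightarrow> scat G \<le> ereal (2 - real p)"
proof -
  have "f 0 \<in> verts G" using f_in_verts two_le_n by simp
  then show ?thesis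
    unfolding ex_spanning_stave_iff[OF \<open>f 0 \<in> verts G\<close>] scat_le_iff
    using ex_list_stave_if_scattering[OF assms] scattering_if_list_stave by blast
qed

end

section \<open>From clique paths to interval orderings\<close>

lemma (in fin_digraph) clique_extends:
  assumes "clique G K"
  shows "\<exists>K'. maximal_clique G K' \<and> K \<subseteq> K'"
proof -
  have "{K'. clique G K'} \<subseteq> Pow (verts G)" by (auto simp: clique_def)
  then have "finite {K'. clique G K'}" by (rule finite_subset) simp
  then obtain K' where "K' \<in> {K'. clique G K'}" "K \<subseteq> K'" "\<forall>B\<in>{K'. clique G K'}. K' \<subseteq> B \<longrightarrow> K' = B"
    using finite_has_maximal2[of "{K'. clique G K'}" K] assms by auto
  then show ?thesis unfolding maximal_clique_def by blast
qed

theorem theorem2: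
  fixes G :: "('a, 'b) pre_digraph" and Cs :: "'a set list" and u\<^sub>1 u\<^sub>n :: 'a and p :: nat
  assumes "interval_graph G"
    and "clique_path G Cs"
    and "u\<^sub>1 \<in> verts G" and "u\<^sub>1 \<in> Cs ! 0"
    and "\<forall>j < length Cs. j \<noteq> 0 \<longrightarrow> u\<^sub>1 \<notin> Cs ! j"
    and "u\<^sub>n \<in> verts G" and "u\<^sub>n \<in> Cs ! (length Cs - 1)"
    and "\<forall>j < length Cs. j \<noteq> length Cs - 1 \<longrightarrow> u\<^sub>n \<notin> Cs ! j"
    and "u\<^sub>1 \<noteq> u\<^sub>n"
    and "p \<ge> 1"
  shows "(\<exists>Ps. spanning_stave G p u\<^sub>1 u\<^sub>n Ps) \<longleftrightarrow> scat G \<le> ereal (2 - real p)"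
proof -
  interpret graph G using assms(1) by (simp add: interval_graph_def)
  define s where "s = length Cs"
  have max_Cs: "\<And>K. K \<in> set Cs \<longleftrightarrow> maximal_clique G K"
    and edge_Cs: "\<And>x y. x \<rightarrow>\<^bsub>G\<^esub> y \<Longrightarrow> \<exists>i<s. x \<in> Cs ! i \<and> y \<in> Cs ! i"
    and consecutive: "\<And>x i j k. \<lbrakk>x \<in> verts G; i \<le> j; j \<le> k; k < s; x \<in> Cs ! i; x \<in> Cs ! k\<rbrakk> \<Longrightarrow> x \<in> Cs ! j"
    using assms(2) unfolding clique_path_def s_def by blast+
  have Cs_adj: "x \<rightarrow>\<^bsub>G\<^esub> y" if "i < s" "x \<in> Cs ! i" "y \<in> Cs ! i" "x \<noteq> y" for i x y
  proof -
    have "maximal_clique G (Cs ! i)" using max_Cs that(1) by (simp add: s_def flip: max_Cs)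
    then have "clique G (Cs ! i)" by (simp add: maximal_clique_def)
    then show ?thesis using that by (auto simp: clique_def)
  qed
  have covered: "\<exists>i<s. x \<in> Cs ! i" if "x \<in> verts G" for x
  proof -
    have "clique G {x}" using that by (simp add: clique_def)
    then obtain K where "maximal_clique G K" "x \<in> K" using clique_extends by blast
    then show ?thesis using max_Cs by (metis in_set_conv_nth s_def)
  qed
  define r where "r x = Max {i. i < s \<and> x \<in> Cs ! i}" for x
  have r: "r x < s" "x \<in> Cs ! r x" if "x \<in> verts G" for x
    using Max_in[of "{i. i < s \<and> x \<in> Cs ! i}"] covered[OF that] by (auto simp: r_def)
  have r_ge: "i \<le> r x" if "i < s" "x \<in> Cs ! i" for i x
    unfolding r_def using that by (intro Max_ge) auto
  have s_pos: "0 < s" using r(1)[OF assms(3)] by simp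
  have u1: "i = 0" if "i < s" "u\<^sub>1 \<in> Cs ! i" for i using assms(5) that by (auto simp: s_def)
  have un: "i = s - 1" if "i < s" "u\<^sub>n \<in> Cs ! i" for i using assms(8) that by (auto simp: s_def)
  obtain ys where ys: "set ys = verts G - {u\<^sub>1, u\<^sub>n}" "distinct ys"
    using finite_distinct_list[of "verts G - {u\<^sub>1, u\<^sub>n}"] by auto
  \<comment> \<open>Ties in \<open>r\<close> may be broken arbitrarily, except that
    \<open>u\<^sub>1\<close> must come first and \<open>u\<^sub>n\<close> last; hence both are set
    aside before sorting.\<close>
  define xs where "xs = sort_key r ys"
  have xs: "set xs = verts G - {u\<^sub>1, u\<^sub>n}" "distinct xs" "sorted (map r xs)"
    using ys by (simp_all add: xs_def)
  define vs where "vs = u\<^sub>1 # xs @ [u\<^sub>n]"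
  define f where "f = (!) vs"
  define n where "n = length vs"
  have vs: "set vs = verts G" "distinct vs" using xs assms(3,6,9) by (auto simp: vs_def)
  have sorted: "sorted (map r vs)"
  proof -
    have "r u\<^sub>1 = 0" using r[OF assms(3)] u1 by blast
    moreover have "r x \<le> r u\<^sub>n" if "x \<in> verts G" for x
      using r(1)[OF that] un[OF r[OF assms(6)]] by simp
    ultimately show ?thesis using xs assms(3) by (auto simp: vs_def sorted_append)
  qed
  have f0: "f 0 = u\<^sub>1" and fn: "f (n - 1) = u\<^sub>n" and n2: "2 \<le> n"
    by (simp_all add: f_def n_def vs_def nth_append)
  have f_bij: "bij_betw f {..<n} (verts G)"
    using bij_betw_nth[OF vs(2), of "{..<n}"] vs(1) by (simp add: f_def n_def)
  have f_verts: "f i \<in> verts G" if "i < n" for i using f_bij that by (auto simp: bij_betw_def)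
  \<comment> \<open>A clique \<open>l\<close> containing \<open>f i\<close> and \<open>f k\<close>
    satisfies \<open>l \<le> r (f j) \<le> r (f k)\<close>, so by consecutiveness \<open>f k\<close>
    meets \<open>f j\<close> in the clique \<open>r (f j)\<close>.\<close>
  have umbrella: "f j \<rightarrow>\<^bsub>G\<^esub> f k" if ijk: "i < j" "j < k" "k < n" "f i \<rightarrow>\<^bsub>G\<^esub> f k" for i j k
  proof -
    obtain l where l: "l < s" "f i \<in> Cs ! l" "f k \<in> Cs ! l" using edge_Cs ijk(4) by blast
    have "r (f i) \<le> r (f j)" "r (f j) \<le> r (f k)"
      using sorted_nth_mono[OF sorted, of i j] sorted_nth_mono[OF sorted, of j k] ijk
      by (simp_all add: f_def n_def)
    then have "l \<le> r (f j)" using r_ge[OF l(1,2)] by simp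
    then have "f k \<in> Cs ! r (f j)"
      using consecutive[of "f k" l "r (f j)" "r (f k)"] l r f_verts ijk \<open>r (f j) \<le> r (f k)\<close> by simp
    moreover have "f j \<noteq> f k" using f_bij ijk by (auto simp: bij_betw_def inj_on_def)
    moreover have "f j \<in> verts G" using f_verts ijk by simp
    ultimately show ?thesis using Cs_adj[OF r(1) r(2)] by blast
  qed
  have last_simplicial: "x \<rightarrow>\<^bsub>G\<^esub> y" if "x \<rightarrow>\<^bsub>G\<^esub> f (n - 1)" "y \<rightarrow>\<^bsub>G\<^esub> f (n - 1)" "x \<noteq> y" for x y
  proof -
    have "z \<in> Cs ! (s - 1)" if "z \<rightarrow>\<^bsub>G\<^esub> u\<^sub>n" for z using edge_Cs[OF that] un by blast
    then show ?thesis using Cs_adj[of "s - 1" x y] that[unfolded fn] s_pos by simp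
  qed
  show ?thesis
  proof (cases "u\<^sub>1 \<rightarrow>\<^bsub>G\<^esub> u\<^sub>n")
    case True
    \<comment> \<open>A common clique of the ends is both the first and the last, so the graph is a
      single clique and both sides of the equivalence hold.\<close>
    then obtain i where "i < s" "u\<^sub>1 \<in> Cs ! i" "u\<^sub>n \<in> Cs ! i" using edge_Cs by blast
    then have s1: "s = 1" using u1[of i] un[of i] s_pos by simp
    have adj: "x \<rightarrow>\<^bsub>G\<^esub> y" if "x \<in> verts G" "y \<in> verts G" "x \<noteq> y" for x y
    proof -
      have "x \<in> Cs ! 0" "y \<in> Cs ! 0" using covered that s1 by auto
      then show ?thesis using Cs_adj that(3) s_pos by blast
    qed
    have "arcs_ends G = {(x, y). (x, y) \<in> verts G \<times> verts G \<and> x \<noteq> y}"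
      using adj adj_in_verts adj_not_same by blast
    then have "complete_digraph (card (verts G)) G"
      using graph_axioms by (simp add: complete_digraph_def)
    then have "scat G \<le> ereal (2 - real p)" by (simp add: scat_def)
    moreover have "\<exists>Q. list_stave (\<lambda>x y. x \<rightarrow>\<^bsub>G\<^esub> y) (verts G) p u\<^sub>1 u\<^sub>n Q"
      using list_stave_complete[of u\<^sub>1 xs u\<^sub>n p "\<lambda>x y. x \<rightarrow>\<^bsub>G\<^esub> y", folded vs_def] vs adj assms(10)
      by auto
    ultimately show ?thesis using ex_spanning_stave_iff[OF assms(3)] by blast
  next
    case False
    interpret interval_ordering G f n
      by unfold_locales (use f_bij umbrella last_simplicial n2 False f0 fn in auto)
    show ?thesis by (rule ex_spanning_stave_iff_scat[OF assms(10), unfolded f0 fn])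
  qed
qed

end
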